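(* Let $m\ge 1$, $K\ge 2$, $n=mK$, and let $A$ be drawn from a strongly assortative balanced block model $\mathrm{BM}^{\mathrm{bal}}_m(\Psi)$ with true cluster matrix $X_0=I_K\otimes E_m$, i.e. one with $$p^-:=\min_k p_k>q^+:=\max_{k\ne\ell}q_{k\ell}.$$ For any $c_1,c_2>0$, let $$C_1:=\max\{C',\tfrac49(c_1+1)\},\qquad C_2:=C+\max\{\sqrt{4(c_1+1)},\;3\sqrt{4(c_2+2)}\}.$$ Put $\tilde p^-:=p^-m/\log n$ and $\tilde q^+:=q^+m/\log n$ and assume $\tilde p^-\ge C_1$. If $$\tilde p^--\tilde q^+>C_2\big(\sqrt{\tilde p^-}+\sqrt{\tilde q^+K}\big),$$ then with probability at least $1-c(Km^{-r}+n^{-r})-n^{-c_1}-2m^{-1}n^{-c_2}$, $X_0$ is the unique solution of SDP-$2'$ with input $A$.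
   Context: **Model.** Let $n=mK$ and let $S_1,\dots,S_K$ be the consecutive blocks of size $m$ partitioning $[n]$. $\Psi\in[0,1]^{K\times K}$ is symmetric, $p_k:=\Psi_{kk}$, $q_{k\ell}:=\Psi_{k\ell}$ for $k\ne\ell$. $A\sim\mathrm{BM}^{\mathrm{bal}}_m(\Psi)$ means: $A$ is a symmetric $n\times n$ matrix whose entries $A_{ij}$, $i<j$, are independent Bernoulli variables with $\mathbb E A_{ij}=\Psi_{k\ell}$ for $i\in S_k,\ j\in S_\ell$. Diagonal entries of $A$ are not part of the data and may be fixed arbitrarily (they do not affect the solution set of the SDP below because $\mathrm{diag}(X)$ is fixed). $E_m$ denotes the $m\times m$ all-ones matrix and $\mathbf 1_n$ the all-ones vector. **SDP-$2'$:** maximize $\langle A,X\rangle=\mathrm{tr}(AX)$ over symmetric $X\in\mathbb R^{n\times n}$ subject to $\langle E_n,X\rangle=n^2/K$, $\mathrm{diag}(X)=\mathbf 1_n$, $X\succeq 0$ (positive semidefinite), $X\ge 0$ (entrywise). **Constants.** $(C,C',c,r)$ are fixed universal positive constants with the following (known) property: for every $N$ and every symmetric random matrix $B\in\{0,1\}^{N\times N}$ with independent lower-triangular entries and zero diagonal, if $\max_{ij}\mathrm{Var}(B_{ij})\le\sigma^2$ with $N\sigma^2\ge C'\log N$, then with probability at least $1-cN^{-r}$ one has $\|B-\mathbb E B\|\le C\sigma\sqrt N$ (operator norm). *)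

theory Defs
  imports "HOL-Probability.Probability" "Jordan_Normal_Form.Matrix"
begin

definition symmetric_mat :: "real mat \<Rightarrow> bool" where
  "symmetric_mat X \<longleftrightarrow> transpose_mat X = X"

definition trace_mat :: "real mat \<Rightarrow> real" where
  "trace_mat X = (\<Sum>i<dim_row X. X $$ (i, i))"

definition mat_inner :: "real mat \<Rightarrow> real mat \<Rightarrow> real" where
  "mat_inner X Y = trace_mat (X * Y)"

definition ones_mat :: "nat \<Rightarrow> real mat" where
  "ones_mat n = mat n n (\<lambda>_. 1)"

definition kronecker_mat :: "real mat \<Rightarrow> real mat \<Rightarrow> real mat" where
  "kronecker_mat X Y = mat (dim_row X * dim_row Y) (dim_col X * dim_col Y)
     (\<lambda>(i, j). X $$ (i div dim_row Y, j div dim_col Y) * Y $$ (i mod dim_row Y, j mod dim_col Y))"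

definition psd_mat :: "nat \<Rightarrow> real mat \<Rightarrow> bool" where
  "psd_mat n X \<longleftrightarrow> X \<in> carrier_mat n n \<and> symmetric_mat X \<and>
     (\<forall>v \<in> carrier_vec n. 0 \<le> scalar_prod v (X *\<^sub>v v))"

definition euclidean_norm_vec :: "real Matrix.vec \<Rightarrow> real" where
  "euclidean_norm_vec v = sqrt (scalar_prod v v)"

text \<open>The supremum runs over the unit ball rather than the unit sphere, so that the set is
  nonempty in every dimension.\<close>
definition op_norm_mat :: "real mat \<Rightarrow> real" where
  "op_norm_mat X =
     (SUP v \<in> {v \<in> carrier_vec (dim_col X). euclidean_norm_vec v \<le> 1}. euclidean_norm_vec (X *\<^sub>v v))"

text \<open>Indices are zero-based: with blocks of size \<open>m\<close>, vertex \<open>i\<close> lies in the block number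
  \<open>i div m\<close>. The diagonal of \<open>A\<close> is left completely unconstrained (it may even be random and
  dependent on the other entries).\<close>
definition balanced_block_model ::
  "'w measure \<Rightarrow> nat \<Rightarrow> nat \<Rightarrow> real mat \<Rightarrow> ('w \<Rightarrow> real mat) \<Rightarrow> bool" where
  "balanced_block_model M m K \<Psi> A \<longleftrightarrow>
     prob_space M \<and>
     \<Psi> \<in> carrier_mat K K \<and> symmetric_mat \<Psi> \<and>
     (\<forall>k<K. \<forall>l<K. \<Psi> $$ (k, l) \<in> {0..1}) \<and>
     (\<forall>\<omega> \<in> space M. A \<omega> \<in> carrier_mat (m * K) (m * K) \<and> symmetric_mat (A \<omega>) \<and>
        (\<forall>i j. i < j \<and> j < m * K \<longrightarrow> A \<omega> $$ (i, j) \<in> {0, 1})) \<and>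
     prob_space.indep_vars M (\<lambda>_. borel) (\<lambda>(i, j) \<omega>. A \<omega> $$ (i, j)) {(i, j). i < j \<and> j < m * K} \<and>
     (\<forall>i j. i < j \<and> j < m * K \<longrightarrow>
        prob_space.expectation M (\<lambda>\<omega>. A \<omega> $$ (i, j)) = \<Psi> $$ (i div m, j div m))"

definition p_minus :: "nat \<Rightarrow> real mat \<Rightarrow> real" where
  "p_minus K \<Psi> = Min {\<Psi> $$ (k, k) | k. k < K}"

definition q_plus :: "nat \<Rightarrow> real mat \<Rightarrow> real" where
  "q_plus K \<Psi> = Max {\<Psi> $$ (k, l) | k l. k < K \<and> l < K \<and> k \<noteq> l}"

definition strongly_assortative :: "nat \<Rightarrow> real mat \<Rightarrow> bool" where
  "strongly_assortative K \<Psi> \<longleftrightarrow> p_minus K \<Psi> > q_plus K \<Psi>"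

definition sdp_feasible :: "nat \<Rightarrow> nat \<Rightarrow> real mat set" where
  "sdp_feasible n K = {X \<in> carrier_mat n n.
     symmetric_mat X \<and>
     mat_inner (ones_mat n) X = real n ^ 2 / real K \<and>
     (\<forall>i<n. X $$ (i, i) = 1) \<and>
     psd_mat n X \<and>
     (\<forall>i<n. \<forall>j<n. 0 \<le> X $$ (i, j))}"

definition sdp_solutions :: "nat \<Rightarrow> nat \<Rightarrow> real mat \<Rightarrow> real mat set" where
  "sdp_solutions n K A =
     {X \<in> sdp_feasible n K. \<forall>Y \<in> sdp_feasible n K. mat_inner A Y \<le> mat_inner A X}"

definition mean_mat :: "nat \<Rightarrow> real mat pmf \<Rightarrow> real mat" where
  "mean_mat N \<mu> = mat N N (\<lambda>(i, j). measure_pmf.expectation \<mu> (\<lambda>B. B $$ (i, j)))"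

text \<open>Laws of symmetric 0/1-valued random matrices with zero diagonal and independent entries
  below the diagonal. Such a matrix takes only finitely many values, so every law arises as a
  \<open>pmf\<close>; quantifying over laws is quantifying over all such random matrices.\<close>
definition symmetric_binary_law :: "nat \<Rightarrow> real mat pmf \<Rightarrow> bool" where
  "symmetric_binary_law N \<mu> \<longleftrightarrow>
     (\<forall>B \<in> set_pmf \<mu>. B \<in> carrier_mat N N \<and> symmetric_mat B \<and>
        (\<forall>i<N. \<forall>j<N. B $$ (i, j) \<in> {0, 1}) \<and> (\<forall>i<N. B $$ (i, i) = 0)) \<and>
     prob_space.indep_vars (measure_pmf \<mu>) (\<lambda>_. borel) (\<lambda>(i, j) B. B $$ (i, j))
       {(i, j). j \<le> i \<and> i < N}"

definition concentration_constants :: "real \<Rightarrow> real \<Rightarrow> real \<Rightarrow> real \<Rightarrow> bool" where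
  "concentration_constants C C' c r \<longleftrightarrow>
     C > 0 \<and> C' > 0 \<and> c > 0 \<and> r > 0 \<and>
     (\<forall>N \<mu> \<sigma>. N \<ge> 1 \<and> \<sigma> \<ge> 0 \<and> symmetric_binary_law N \<mu> \<and>
        (\<forall>i<N. \<forall>j<N. measure_pmf.variance \<mu> (\<lambda>B. B $$ (i, j)) \<le> \<sigma> ^ 2) \<and>
        real N * \<sigma> ^ 2 \<ge> C' * ln (real N) \<longrightarrow>
        measure_pmf.prob \<mu> {B. op_norm_mat (B - mean_mat N \<mu>) \<le> C * \<sigma> * sqrt (real N)}
          \<ge> 1 - c * real N powr (- r))"

end

(*
  Primal-dual witness. Let d_i(S) be the number of neighbours of i in S. On the
  diagonal blocks put Lambda = mu E + diag(nu) - A with nu_i = d_i(S_k) - m mu, and on the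
  off-diagonal blocks let Lambda be minus the doubly centred block of A, with
  Gamma = mu E - Lambda - A there and Gamma = 0 on the diagonal blocks. Then Lambda kills all
  cluster indicators, and <A, X0 - X> = <Lambda, X> + <Gamma, X> for feasible X. So X0 is the unique
  optimum once Gamma >= 0 and Lambda is positive definite on the vectors with zero block sums.

  Gamma >= 0 is a statement about degrees into foreign blocks and about edge counts between blocks,
  which Chernoff bounds control. On vectors with zero block sums the mean of A contributes only
  -p_k |u|^2, so positive definiteness compares the degrees d_i(S_k) with the operator norm of
  A - EA. That norm is bounded by the concentration property, applied to each diagonal block
  separately and to the off-diagonal part. For the latter the variance proxy is max(q+, p-/K): with
  q+ alone the requirement N sigma^2 >= C' log N may fail. The proxy costs an additional
  C sqrt(p-), which is affordable because the hypotheses force p- m >= 72 log n, hence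
  log n >= 4, and in units of log n the norm bounds carry a factor 1/sqrt(log n) <= 1/2.
*)
theory Submission
  imports Defs
begin

section \<open>Dual certificate\<close>

text \<open>Complementary slackness shapes the multipliers: \<open>\<Lambda>\<close> must kill the
  cluster indicators, so every block of it has zero row sums, and \<Gamma> must vanish wherever X0
  does not. On an off-diagonal block, double centring is the orthogonal projection of -A onto zero
  row and column sums; the terms it adds are invisible to vectors with zero block sums. Only the
  scalar \<mu>, the multiplier of <E,X>, stays free: large enough for \<Gamma> >= 0, small enough to
  stay below the degrees.

  With w = (c2+2) log n, one entry of \<Gamma> involves two degrees and one edge count. Each
  fluctuates by at most 2 sqrt(w q m), whence 6 sqrt(c2+2) = 3 sqrt(4(c2+2)). The inner degree needs
  only sqrt(2(c1+1)); the surplus of sqrt(4(c1+1)) over it pays for the linear term 2w of the upper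
  tails.

  A lives on an arbitrary probability space and has a free diagonal, while the concentration
  property speaks of discrete laws with zero diagonal. Recovery is therefore expressed through
  finitely many independent Booleans, one per edge, before anything is estimated.\<close>

text \<open>Cholesky elimination of the last index. It stands in for the spectral theorem: pairing a
  matrix with \<open>f\<close> becomes a sum of its quadratic form over the rows of
  \<open>V\<close>, which serves both the sign and the equality case of duality.\<close>

lemma gram_factorization:
  fixes f :: "nat \<Rightarrow> nat \<Rightarrow> real"
  assumes "\<And>i j. i < n \<Longrightarrow> j < n \<Longrightarrow> f i j = f j i"
    and "\<And>v. 0 \<le> (\<Sum>i<n. \<Sum>j<n. f i j * v i * v j)"
  shows "\<exists>V. \<forall>i<n. \<forall>j<n. f i j = (\<Sum>t<n. V t i * V t j)"
  using assms
proof (induction n arbitrary: f)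
  case 0
  then show ?case by simp
next
  case (Suc n)
  define a where "a = f n n"
  have expand: "(\<Sum>i<Suc n. \<Sum>j<Suc n. f i j * v i * v j)
      = (\<Sum>i<n. \<Sum>j<n. f i j * v i * v j) + 2 * v n * (\<Sum>i<n. f i n * v i) + a * (v n)\<^sup>2" for v
  proof -
    have "(\<Sum>j<n. f n j * v n * v j) = v n * (\<Sum>i<n. f i n * v i)"
      unfolding sum_distrib_left by (rule sum.cong) (use Suc.prems(1) in auto)
    moreover have "(\<Sum>i<n. f i n * v i * v n) = v n * (\<Sum>i<n. f i n * v i)"
      unfolding sum_distrib_left by (rule sum.cong) auto
    ultimately show ?thesis
      by (simp add: sum.distrib a_def power2_eq_square)
  qed
  have quad: "0 \<le> (\<Sum>i<n. \<Sum>j<n. f i j * v i * v j) + 2 * s * (\<Sum>i<n. f i n * v i) + a * s\<^sup>2" for v s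
  proof -
    have "0 \<le> (\<Sum>i<Suc n. \<Sum>j<Suc n. f i j * (v(n := s)) i * (v(n := s)) j)"
      by (rule Suc.prems(2))
    then show ?thesis unfolding expand by simp
  qed
  have "a \<ge> 0" using quad[of "\<lambda>_. 0" 1] by simp
  have null: "f i n = 0" if "a = 0" "i < n" for i
  proof (rule ccontr)
    assume nz: "f i n \<noteq> 0"
    \<comment> \<open>With a zero corner the form is affine in the last coordinate, so a nonzero
      slope would allow negative values; this \<open>s\<close> produces exactly -1.\<close>
    define s where "s = - (f i i + 1) / (2 * f i n)"
    have *: "(\<Sum>j<n. g j * (if j = i then 1 else 0)) = g i" for g :: "nat \<Rightarrow> real"
      using that by (simp add: if_distrib cong: if_cong)
    have "(\<Sum>k<n. \<Sum>j<n. f k j * (if k = i then 1 else 0) * (if j = i then 1 else 0)) = f i i"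
      by (simp add: *)
    with quad[of "\<lambda>j. if j = i then 1 else 0" s] have "0 \<le> f i i + 2 * s * f i n"
      using that(1) by (simp add: *)
    also have "\<dots> = -1" using nz by (simp add: s_def field_simps)
    finally show False by simp
  qed
  \<comment> \<open>Schur complement; if \<open>a = 0\<close> then the last row vanishes and division by zero gives \<open>g = f\<close>.\<close>
  define g where "g i j = f i j - f i n * f j n / a" for i j
  have "\<exists>V. \<forall>i<n. \<forall>j<n. g i j = (\<Sum>t<n. V t i * V t j)"
  proof (rule Suc.IH)
    show "g i j = g j i" if "i < n" "j < n" for i j
      using Suc.prems(1)[of i j] that by (simp add: g_def mult.commute)
    show "0 \<le> (\<Sum>i<n. \<Sum>j<n. g i j * v i * v j)" for v
    proof -
      define b where "b = (\<Sum>i<n. f i n * v i)"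
      have "(\<Sum>i<n. \<Sum>j<n. g i j * v i * v j)
          = (\<Sum>i<n. \<Sum>j<n. f i j * v i * v j) - (\<Sum>i<n. \<Sum>j<n. (f i n * v i) * (f j n * v j)) / a"
        unfolding g_def by (simp add: algebra_simps sum_subtractf sum_divide_distrib)
      also have "(\<Sum>i<n. \<Sum>j<n. (f i n * v i) * (f j n * v j)) = b * b"
        unfolding b_def sum_product ..
      finally have eq: "(\<Sum>i<n. \<Sum>j<n. g i j * v i * v j)
          = (\<Sum>i<n. \<Sum>j<n. f i j * v i * v j) - b * b / a" .
      show ?thesis
      proof (cases "a = 0")
        case True
        then show ?thesis using quad[of v 0] eq by simp
      next
        case False
        \<comment> \<open>\<open>- b / a\<close> minimises the form in its last coordinate, and the
          minimum is the form of the Schur complement.\<close>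
        have "2 * (- b / a) * b + a * (- b / a)\<^sup>2 = - (b * b / a)"
            using False by (simp add: power2_eq_square field_simps)
          with quad[of v "- b / a"] eq show ?thesis by (simp add: b_def[symmetric])
      qed
    qed
  qed
  then obtain V where V: "g i j = (\<Sum>t<n. V t i * V t j)" if "i < n" "j < n" for i j
    by blast
  \<comment> \<open>The new row is the last column over \<open>sqrt a\<close>. If
    \<open>a = 0\<close>, division by zero makes it the zero row, in agreement with
    \<open>null\<close>.\<close>
  define W where "W t i = (if t < n then if i < n then V t i else 0 else f i n / sqrt a)" for t i
  have "f i j = (\<Sum>t<Suc n. W t i * W t j)" if ij: "i < Suc n" "j < Suc n" for i j
  proof -
    have W: "(\<Sum>t<Suc n. W t i * W t j)
      = (if i < n \<and> j < n then g i j else 0) + f i n * f j n / a"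
      using V[of i j] \<open>a \<ge> 0\<close> by (auto simp: W_def)
    consider "i < n" "j < n" | "i = n" "j < n" | "i < n" "j = n" | "i = n" "j = n"
      using ij by (auto simp: less_Suc_eq)
    then show ?thesis
    proof cases
      case 1
      then show ?thesis using W by (simp add: g_def)
    next
      case 2
      then show ?thesis using W Suc.prems(1)[of n j] null[of j]
        by (cases "a = 0") (auto simp: a_def)
    next
      case 3
      then show ?thesis using W null[of i]
        by (cases "a = 0") (auto simp: a_def)
    next
      case 4
      then show ?thesis using W by (auto simp: a_def)
    qed
  qed
  then show ?case by blast
qed

section \<open>Consecutive blocks and sums over them\<close>

definition blk :: "nat \<Rightarrow> nat \<Rightarrow> nat set" where
  "blk m k = {k * m..<k * m + m}"

lemma finite_blk [simp]: "finite (blk m k)"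
  by (simp add: blk_def)

lemma card_blk [simp]: "card (blk m k) = m"
  by (simp add: blk_def)

lemma mem_blk_iff: "m > 0 \<Longrightarrow> i \<in> blk m k \<longleftrightarrow> i div m = k"
  unfolding blk_def by (auto simp: div_nat_eqI mult.commute) (metis dividend_less_div_times mult.commute add.commute)+

lemma div_blk [simp]: "i \<in> blk m k \<Longrightarrow> i div m = k"
  unfolding blk_def by (auto intro!: div_nat_eqI simp: mult.commute)

lemma blk_less: "i \<in> blk m k \<Longrightarrow> k < K \<Longrightarrow> i < m * K"
proof -
  assume "i \<in> blk m k" "k < K"
  then have "i < Suc k * m" "Suc k * m \<le> K * m"
    by (auto simp: blk_def, metis Suc_leI mult_Suc mult_le_mono1)
  then show ?thesis by (simp add: mult.commute)
qed

lemma div_less_blocks: "i < m * K \<Longrightarrow> i div m < (K::nat)"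
  by (simp add: less_mult_imp_div_less mult.commute)

lemma sum_blocks: "(\<Sum>i<m * K. f i) = (\<Sum>k<K. \<Sum>i\<in>blk m k. f i)"
  unfolding blk_def sum.nat_group by (simp add: mult.commute)

text \<open>Orthogonality of block-constant functions to vectors with zero block sums. It removes
  the centring terms from the certificate and, later, the mean of A from the quadratic form.\<close>

lemma sum_block_constant_mult:
  fixes w :: "nat \<Rightarrow> real"
  assumes "\<And>k. k < K \<Longrightarrow> (\<Sum>j\<in>blk m k. w j) = 0"
  shows "(\<Sum>j<m * K. g (j div m) * w j) = 0"
  unfolding sum_blocks
proof (rule sum.neutral, rule ballI)
  fix k assume "k \<in> {..<K}"
  have "(\<Sum>j\<in>blk m k. g (j div m) * w j) = g k * (\<Sum>j\<in>blk m k. w j)"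
    unfolding sum_distrib_left by (rule sum.cong) simp_all
  with assms \<open>k \<in> {..<K}\<close> show "(\<Sum>j\<in>blk m k. g (j div m) * w j) = 0" by simp
qed

text \<open>Weak duality: \<open>between\<close> is \<Gamma> >= 0 on the off-diagonal blocks,
  \<open>within\<close> is definiteness of \<open>\<Lambda>\<close> modulo block-constant vectors.
  Equality forces each Gram row to be block-constant, so \<open>x\<close> is 1 on the diagonal
  blocks; these already use up the prescribed total \<open>xsum\<close>, and nonnegativity leaves 0
  elsewhere. Hence \<Gamma> may have zeros off the diagonal blocks without harming
  uniqueness.\<close>

lemma sdp_certificate:
  fixes a :: "nat \<Rightarrow> nat \<Rightarrow> real" and m K :: nat
  defines "n \<equiv> m * K"
    and "d \<equiv> \<lambda>i l. \<Sum>j\<in>blk m l. a i j"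
    and "D \<equiv> \<lambda>k l. \<Sum>i\<in>blk m k. \<Sum>j\<in>blk m l. a i j"
  assumes m: "m > 0"
    and asym: "\<And>i j. i < n \<Longrightarrow> j < n \<Longrightarrow> a i j = a j i"
    and between: "\<And>k l i j. \<lbrakk>k < K; l < K; k \<noteq> l; i \<in> blk m k; j \<in> blk m l\<rbrakk>
      \<Longrightarrow> d i l / m + d j k / m - D k l / m^2 \<le> \<mu>"
    and within: "\<And>u. \<lbrakk>\<And>k. k < K \<Longrightarrow> (\<Sum>i\<in>blk m k. u i) = 0; \<exists>i<n. u i \<noteq> 0\<rbrakk>
      \<Longrightarrow> (\<Sum>i<n. \<Sum>j<n. a i j * u i * u j) < (\<Sum>i<n. (d i (i div m) - \<mu> * m) * (u i)\<^sup>2)"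
    and xsym: "\<And>i j. i < n \<Longrightarrow> j < n \<Longrightarrow> x i j = x j i"
    and xpsd: "\<And>v. 0 \<le> (\<Sum>i<n. \<Sum>j<n. x i j * v i * v j)"
    and xdiag: "\<And>i. i < n \<Longrightarrow> x i i = 1"
    and xpos: "\<And>i j. i < n \<Longrightarrow> j < n \<Longrightarrow> 0 \<le> x i j"
    and xsum: "(\<Sum>i<n. \<Sum>j<n. x i j) = real K * (real m)\<^sup>2"
  shows "(\<Sum>i<n. \<Sum>j<n. a i j * x i j) \<le> (\<Sum>k<K. D k k)"
    and "(\<Sum>i<n. \<Sum>j<n. a i j * x i j) = (\<Sum>k<K. D k k)
      \<Longrightarrow> \<forall>i<n. \<forall>j<n. x i j = (if i div m = j div m then 1 else 0)"
proof -
  \<comment> \<open>On off-diagonal blocks \<open>\<alpha> i (j div m) + \<beta> j (i div m)\<close> is the projection of \<open>a\<close> to its block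
    row and column means; it is split so that each part is block-constant in one index.\<close>
  define \<nu> where "\<nu> i = d i (i div m) - \<mu> * m" for i
  define \<alpha> where "\<alpha> i l = (if i div m = l then \<mu> else d i l / m - D (i div m) l / m^2)" for i l
  define \<beta> where "\<beta> j k = (if j div m = k then 0 else d j k / m)" for j k
  define \<Lambda> where "\<Lambda> i j = \<alpha> i (j div m) + \<beta> j (i div m) - a i j + (if i = j then \<nu> i else 0)" for i j
  define \<Gamma> where "\<Gamma> i j = \<mu> - \<alpha> i (j div m) - \<beta> j (i div m)" for i j
  define Q where "Q v = (\<Sum>i<n. \<Sum>j<n. \<Lambda> i j * v i * v j)" for v
  have bl: "i \<in> blk m k \<Longrightarrow> k < K \<Longrightarrow> i < n" for i k
    unfolding n_def by (rule blk_less)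
  have inblk: "i \<in> blk m (i div m)" for i using m by (simp add: mem_blk_iff del: div_blk)
  have dl: "i < n \<Longrightarrow> i div m < K" for i unfolding n_def by (rule div_less_blocks)
  have D_d: "D k l = (\<Sum>i\<in>blk m k. d i l)" for k l by (simp add: D_def d_def)
  have D_sym: "D k l = D l k" if "k < K" "l < K" for k l
    unfolding D_def by (subst sum.swap) (intro sum.cong refl asym, use that bl in auto)
  have \<Gamma>0: "\<Gamma> i j = 0" if "i div m = j div m" for i j
    using that by (simp add: \<Gamma>_def \<alpha>_def \<beta>_def)
  have \<Gamma>_pos: "0 \<le> \<Gamma> i j" if "i < n" "j < n" for i j
    using between[OF dl[OF that(1)] dl[OF that(2)] _ inblk inblk] \<Gamma>0[of i j]
    by (cases "i div m = j div m") (auto simp: \<Gamma>_def \<alpha>_def \<beta>_def)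
  have \<Lambda>_sym: "\<Lambda> i j = \<Lambda> j i" if "i < n" "j < n" for i j
    using asym[OF that] D_sym[OF dl[OF that(1)] dl[OF that(2)]] by (auto simp: \<Lambda>_def \<alpha>_def \<beta>_def)
  have rows: "(\<Sum>j\<in>blk m l. \<Lambda> i j) = 0" if "i < n" "l < K" for i l
  proof -
    have "(\<Sum>j\<in>blk m l. \<Lambda> i j)
      = m * \<alpha> i l + (\<Sum>j\<in>blk m l. \<beta> j (i div m)) - d i l + (\<Sum>j\<in>blk m l. if i = j then \<nu> i else 0)"
      by (simp add: \<Lambda>_def sum.distrib sum_subtractf d_def)
    also have "(\<Sum>j\<in>blk m l. if i = j then \<nu> i else 0) = (if i div m = l then \<nu> i else 0)"
      using m by (simp add: mem_blk_iff del: div_blk)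
    also have "(\<Sum>j\<in>blk m l. \<beta> j (i div m)) = (if i div m = l then 0 else D l (i div m) / m)"
      by (auto simp: \<beta>_def D_d sum_divide_distrib)
    also have "D l (i div m) = D (i div m) l" using D_sym that dl by simp
    finally show ?thesis using m
      by (cases "i div m = l") (simp_all add: \<alpha>_def \<nu>_def power2_eq_square right_diff_distrib mult.commute)
  qed
  \<comment> \<open>By \<open>rows\<close> and symmetry \<open>v\<close> may be replaced by its
    block-centred part \<open>u\<close> on both sides of the form; on \<open>u\<close> only the
    diagonal \<open>\<nu>\<close> and the original \<open>a\<close> survive.\<close>
  have form: "Q v = (\<Sum>i<n. \<nu> i * (u i)\<^sup>2) - (\<Sum>i<n. \<Sum>j<n. a i j * u i * u j)"
    and zero_sum: "\<And>k. k < K \<Longrightarrow> (\<Sum>i\<in>blk m k. u i) = 0"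
    if u: "\<And>i. u i = v i - (\<Sum>j\<in>blk m (i div m). v j) / m" for u v
  proof -
    define c where "c k = (\<Sum>j\<in>blk m k. v j) / m" for k
    have v: "v i = u i + c (i div m)" for i by (simp add: u c_def)
    show zs: "(\<Sum>i\<in>blk m k. u i) = 0" if "k < K" for k
    proof -
      have "(\<Sum>i\<in>blk m k. u i) = (\<Sum>i\<in>blk m k. v i - c k)"
        by (intro sum.cong) (simp_all add: u c_def)
      then show ?thesis using m by (simp add: sum_subtractf c_def)
    qed
    have 1: "(\<Sum>j<n. c (j div m) * \<Lambda> i j) = 0" if "i < n" for i
      unfolding n_def by (rule sum_block_constant_mult) (use rows that in auto)
    have vu: "(\<Sum>j<n. \<Lambda> i j * v j) = (\<Sum>j<n. \<Lambda> i j * u j)" if "i < n" for i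
    proof -
      have "(\<Sum>j<n. \<Lambda> i j * v j) = (\<Sum>j<n. \<Lambda> i j * u j + c (j div m) * \<Lambda> i j)"
        by (intro sum.cong refl) (simp add: v distrib_left)
      then show ?thesis by (simp add: sum.distrib 1[OF that])
    qed
    have "Q v = (\<Sum>i<n. v i * (\<Sum>j<n. \<Lambda> i j * v j))"
      by (simp add: Q_def sum_distrib_left algebra_simps)
    also have "\<dots> = (\<Sum>i<n. v i * (\<Sum>j<n. \<Lambda> i j * u j))"
      by (intro sum.cong refl) (simp add: vu)
    also have "\<dots> = (\<Sum>i<n. \<Sum>j<n. v i * (\<Lambda> i j * u j))" by (simp add: sum_distrib_left)
    also have "\<dots> = (\<Sum>j<n. \<Sum>i<n. v i * (\<Lambda> i j * u j))" by (rule sum.swap)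
    also have "\<dots> = (\<Sum>j<n. u j * (\<Sum>i<n. \<Lambda> j i * v i))"
      unfolding sum_distrib_left by (intro sum.cong refl) (use \<Lambda>_sym in simp)
    also have "\<dots> = (\<Sum>j<n. u j * (\<Sum>i<n. \<Lambda> j i * u i))"
      by (intro sum.cong refl) (simp add: vu)
    also have "\<dots> = (\<Sum>i<n. \<Sum>j<n. \<alpha> i (j div m) * u j * u i) + (\<Sum>i<n. \<Sum>j<n. \<beta> j (i div m) * u i * u j)
        - (\<Sum>i<n. \<Sum>j<n. a i j * u i * u j) + (\<Sum>i<n. \<Sum>j<n. if i = j then \<nu> i * u i * u j else 0)"
      unfolding sum_distrib_left sum.distrib[symmetric] sum_subtractf[symmetric]
      by (intro sum.cong refl) (simp add: \<Lambda>_def algebra_simps)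
    also have "(\<Sum>i<n. \<Sum>j<n. \<alpha> i (j div m) * u j * u i) = 0"
      unfolding sum_distrib_right[symmetric] n_def
      by (subst sum_block_constant_mult) (use zs in auto)
    \<comment> \<open>\<open>\<beta>\<close> is block-constant in the outer index, so the order of
      summation is exchanged before the zero block sums apply.\<close>
    also have "(\<Sum>i<n. \<Sum>j<n. \<beta> j (i div m) * u i * u j) = (\<Sum>j<n. (\<Sum>i<n. \<beta> j (i div m) * u i) * u j)"
      unfolding sum_distrib_right by (rule sum.swap)
    also have "\<dots> = 0"
      unfolding n_def by (subst sum_block_constant_mult) (use zs in auto)
    finally show "Q v = (\<Sum>i<n. \<nu> i * (u i)\<^sup>2) - (\<Sum>i<n. \<Sum>j<n. a i j * u i * u j)"
      by (simp add: power2_eq_square mult.assoc)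
  qed
  have Q: "0 \<le> Q v" "Q v = 0 \<Longrightarrow> i < n \<Longrightarrow> j < n \<Longrightarrow> i div m = j div m \<Longrightarrow> v i = v j" for v i j
  proof -
    define u where "u i = v i - (\<Sum>j\<in>blk m (i div m). v j) / m" for i
    have pos: "0 < Q v" if "\<exists>i<n. u i \<noteq> 0"
      using within[OF zero_sum[OF u_def] that] unfolding form[OF u_def] \<nu>_def by simp
    have "Q v = 0" if "\<not> (\<exists>i<n. u i \<noteq> 0)"
      using that unfolding form[OF u_def] by simp
    with pos show "0 \<le> Q v" by force
    assume "Q v = 0" "i < n" "j < n" "i div m = j div m"
    then have "u i = 0" "u j = 0" using pos by auto
    then show "v i = v j" using \<open>i div m = j div m\<close> by (simp add: u_def)
  qed
  obtain V where V: "\<And>i j. i < n \<Longrightarrow> j < n \<Longrightarrow> x i j = (\<Sum>t<n. V t i * V t j)"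
    using gram_factorization[of n x] xsym xpsd by blast
  have \<Lambda>x: "(\<Sum>i<n. \<Sum>j<n. \<Lambda> i j * x i j) = (\<Sum>t<n. Q (V t))"
  proof -
    have "(\<Sum>i<n. \<Sum>j<n. \<Lambda> i j * x i j) = (\<Sum>i<n. \<Sum>j<n. \<Sum>t<n. \<Lambda> i j * V t i * V t j)"
      by (intro sum.cong refl) (simp add: V sum_distrib_left mult.assoc)
    also have "\<dots> = (\<Sum>i<n. \<Sum>t<n. \<Sum>j<n. \<Lambda> i j * V t i * V t j)"
      by (intro sum.cong refl sum.swap)
    also have "\<dots> = (\<Sum>t<n. Q (V t))" unfolding Q_def by (rule sum.swap)
    finally show ?thesis .
  qed
  \<comment> \<open>The constraints evaluate the multiplier terms: the total gives
    \<open>\<mu> * K * m^2\<close>, the unit diagonal gives the sum of \<open>\<nu>\<close>. Their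
    \<open>\<mu>\<close> parts cancel because \<open>m * n = K * m^2\<close>.\<close>
  have dual: "(\<Sum>i<n. \<Sum>j<n. a i j * x i j)
    = (\<Sum>k<K. D k k) - (\<Sum>t<n. Q (V t)) - (\<Sum>i<n. \<Sum>j<n. \<Gamma> i j * x i j)"
  proof -
    have "(\<Sum>i<n. \<Sum>j<n. a i j * x i j) = (\<Sum>i<n. \<Sum>j<n. \<mu> * x i j)
      + (\<Sum>i<n. \<Sum>j<n. if i = j then \<nu> i * x i j else 0)
      - (\<Sum>i<n. \<Sum>j<n. \<Lambda> i j * x i j) - (\<Sum>i<n. \<Sum>j<n. \<Gamma> i j * x i j)"
      unfolding sum.distrib[symmetric] sum_subtractf[symmetric]
      by (intro sum.cong refl) (simp add: \<Lambda>_def \<Gamma>_def algebra_simps)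
    also have "(\<Sum>i<n. \<Sum>j<n. \<mu> * x i j) = \<mu> * (real K * (real m)\<^sup>2)"
      by (simp add: sum_distrib_left[symmetric] xsum)
    also have "(\<Sum>i<n. \<Sum>j<n. if i = j then \<nu> i * x i j else 0) = (\<Sum>i<n. \<nu> i)"
      by (simp add: xdiag)
    also have "\<dots> = (\<Sum>i<n. d i (i div m)) - \<mu> * m * n"
      by (simp add: \<nu>_def sum_subtractf)
    also have "(\<Sum>i<n. d i (i div m)) = (\<Sum>k<K. D k k)"
      unfolding n_def sum_blocks D_d by (intro sum.cong) auto
    finally show ?thesis unfolding \<Lambda>x by (simp add: n_def power2_eq_square)
  qed
  have Qpos: "0 \<le> (\<Sum>t<n. Q (V t))" by (intro sum_nonneg Q)
  have \<Gamma>pos: "0 \<le> (\<Sum>i<n. \<Sum>j<n. \<Gamma> i j * x i j)"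
    by (intro sum_nonneg mult_nonneg_nonneg \<Gamma>_pos xpos) auto
  show "(\<Sum>i<n. \<Sum>j<n. a i j * x i j) \<le> (\<Sum>k<K. D k k)"
    using dual Qpos \<Gamma>pos by simp
  assume "(\<Sum>i<n. \<Sum>j<n. a i j * x i j) = (\<Sum>k<K. D k k)"
  then have "(\<Sum>t<n. Q (V t)) = 0" using dual Qpos \<Gamma>pos by simp
  then have Q0: "Q (V t) = 0" if "t < n" for t
    using that Q(1) sum_nonneg_eq_0_iff[of "{..<n}" "\<lambda>t. Q (V t)"] by simp
  have one: "x i j = 1" if "i < n" "j < n" "i div m = j div m" for i j
  proof -
    have "x i j = (\<Sum>t<n. V t i * V t i)"
      unfolding V[OF that(1,2)]
    proof (intro sum.cong refl)
      fix t assume "t \<in> {..<n}"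
      then have "V t i = V t j" using Q(2)[OF Q0[of t] that] by simp
      then show "V t i * V t j = V t i * V t i" by simp
    qed
    then show ?thesis using V[OF that(1) that(1)] xdiag[OF that(1)] by simp
  qed
  \<comment> \<open>The deviation from the cluster matrix has nonnegative entries and total 0, hence
    vanishes.\<close>
  define z where "z i j = x i j - (if i div m = j div m then 1 else 0)" for i j
  have z_pos: "0 \<le> z i j" if "i < n" "j < n" for i j
    using one[OF that] xpos[OF that] by (simp add: z_def)
  have "(\<Sum>i<n. \<Sum>j<n. if i div m = j div m then 1 else (0::real)) = real K * (real m)\<^sup>2"
  proof -
    have "(\<Sum>j<n. if i div m = j div m then 1 else (0::real)) = m" if "i < n" for i
    proof -
      have "(\<Sum>j<n. if i div m = j div m then 1 else (0::real))
        = (\<Sum>l<K. \<Sum>j\<in>blk m l. if i div m = l then 1 else 0)"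
        unfolding n_def sum_blocks by (intro sum.cong) auto
      also have "\<dots> = (\<Sum>l<K. if i div m = l then real m else 0)" by (intro sum.cong) auto
      finally show ?thesis using dl[OF that] by simp
    qed
    then show ?thesis by (simp add: n_def power2_eq_square)
  qed
  then have "(\<Sum>i<n. \<Sum>j<n. z i j) = 0" by (simp add: z_def sum_subtractf xsum)
  moreover have "0 \<le> (\<Sum>j<n. z i j)" if "i < n" for i
    by (intro sum_nonneg z_pos) (use that in auto)
  ultimately have "\<forall>i\<in>{..<n}. (\<Sum>j<n. z i j) = 0"
    using sum_nonneg_eq_0_iff[of "{..<n}" "\<lambda>i. \<Sum>j<n. z i j"] by simp
  then have "z i j = 0" if "i < n" "j < n" for i j
    using sum_nonneg_eq_0_iff[of "{..<n}" "z i"] z_pos that by auto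
  then show "\<forall>i<n. \<forall>j<n. x i j = (if i div m = j div m then 1 else 0)"
    by (simp add: z_def)
qed

section \<open>From index functions to matrices; the cluster matrix\<close>

lemma symmetric_mat_iff:
  "X \<in> carrier_mat n n \<Longrightarrow> symmetric_mat X \<longleftrightarrow> (\<forall>i<n. \<forall>j<n. X $$ (i, j) = X $$ (j, i))"
  unfolding symmetric_mat_def by (auto simp: mat_eq_iff)

lemma mat_inner_eq:
  "\<lbrakk>X \<in> carrier_mat n n; Y \<in> carrier_mat n n\<rbrakk>
    \<Longrightarrow> mat_inner X Y = (\<Sum>i<n. \<Sum>j<n. X $$ (i, j) * Y $$ (j, i))"
  by (simp add: mat_inner_def trace_mat_def scalar_prod_def atLeast0LessThan)

lemma quadratic_form_eq:
  fixes X :: "real mat"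
  assumes "X \<in> carrier_mat n n" "v \<in> carrier_vec n"
  shows "scalar_prod v (X *\<^sub>v v) = (\<Sum>i<n. \<Sum>j<n. X $$ (i, j) * vec_index v i * vec_index v j)"
  using assms
  by (auto simp: scalar_prod_def atLeast0LessThan sum_distrib_left intro!: sum.cong)

lemma psd_mat_quadratic_form:
  assumes "psd_mat n X"
  shows "0 \<le> (\<Sum>i<n. \<Sum>j<n. X $$ (i, j) * v i * v j)"
proof -
  have X: "X \<in> carrier_mat n n" "\<forall>w \<in> carrier_vec n. 0 \<le> scalar_prod w (X *\<^sub>v w)"
    using assms by (auto simp: psd_mat_def)
  have "0 \<le> scalar_prod (Matrix.vec n v) (X *\<^sub>v Matrix.vec n v)" using X(2) by simp
  then show ?thesis by (simp add: quadratic_form_eq[OF X(1)])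
qed

lemma sum_same_block:
  fixes g :: "nat \<Rightarrow> nat \<Rightarrow> real"
  shows "(\<Sum>i<m * K. \<Sum>j<m * K. if i div m = j div m then g i j else 0)
    = (\<Sum>k<K. \<Sum>i\<in>blk m k. \<Sum>j\<in>blk m k. g i j)"
proof -
  have row: "(\<Sum>j<m * K. if i div m = j div m then g i j else 0) = (\<Sum>j\<in>blk m k. g i j)"
    if "i \<in> blk m k" "k < K" for i k
  proof -
    have "(\<Sum>j<m * K. if i div m = j div m then g i j else 0)
      = (\<Sum>l<K. \<Sum>j\<in>blk m l. if k = l then g i j else 0)"
      unfolding sum_blocks using that by (intro sum.cong) auto
    also have "\<dots> = (\<Sum>l<K. if k = l then \<Sum>j\<in>blk m l. g i j else 0)"
      by (intro sum.cong) auto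
    finally show ?thesis using that by simp
  qed
  have "(\<Sum>k<K. \<Sum>i\<in>blk m k. \<Sum>j<m * K. if i div m = j div m then g i j else 0)
    = (\<Sum>k<K. \<Sum>i\<in>blk m k. \<Sum>j\<in>blk m k. g i j)"
    by (rule sum.cong[OF refl], rule sum.cong[OF refl], rule row) auto
  then show ?thesis by (subst sum_blocks)
qed

abbreviation cluster_mat :: "nat \<Rightarrow> nat \<Rightarrow> real mat" where
  "cluster_mat m K \<equiv> kronecker_mat (1\<^sub>m K) (ones_mat m)"

lemma cluster_mat_carrier: "cluster_mat m K \<in> carrier_mat (m * K) (m * K)"
  by (simp add: kronecker_mat_def ones_mat_def mult.commute)

lemma cluster_mat_index:
  assumes "i < m * K" "j < m * K"
  shows "cluster_mat m K $$ (i, j) = (if i div m = j div m then 1 else 0)"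
proof -
  have "m > 0" using assms by (cases m) auto
  then show ?thesis using assms div_less_blocks[OF assms(1)] div_less_blocks[OF assms(2)]
    by (simp add: kronecker_mat_def ones_mat_def mult.commute)
qed

lemma cluster_mat_inner:
  assumes "A \<in> carrier_mat (m * K) (m * K)"
  shows "mat_inner A (cluster_mat m K) = (\<Sum>k<K. \<Sum>i\<in>blk m k. \<Sum>j\<in>blk m k. A $$ (i, j))"
proof -
  have "mat_inner A (cluster_mat m K)
    = (\<Sum>i<m*K. \<Sum>j<m*K. if i div m = j div m then A $$ (i, j) else 0)"
    unfolding mat_inner_eq[OF assms cluster_mat_carrier]
    by (intro sum.cong refl) (simp add: cluster_mat_index eq_commute)
  then show ?thesis by (simp add: sum_same_block)
qed

lemma cluster_mat_feasible:
  assumes "m > 0" "K > 0"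
  shows "cluster_mat m K \<in> sdp_feasible (m * K) K"
proof -
  let ?n = "m * K" and ?X = "cluster_mat m K"
  have sym: "symmetric_mat ?X"
    unfolding symmetric_mat_iff[OF cluster_mat_carrier] by (auto simp: cluster_mat_index)
  have ones: "ones_mat ?n \<in> carrier_mat ?n ?n" by (simp add: ones_mat_def)
  have "(\<Sum>i\<in>blk m k. \<Sum>j\<in>blk m k. ones_mat ?n $$ (i, j)) = real m * real m" if "k < K" for k
  proof -
    have "(\<Sum>i\<in>blk m k. \<Sum>j\<in>blk m k. ones_mat ?n $$ (i, j)) = (\<Sum>i\<in>blk m k. \<Sum>j\<in>blk m k. 1)"
      by (intro sum.cong refl) (simp add: ones_mat_def blk_less[OF _ that])
    then show ?thesis by simp
  qed
  then have inner: "mat_inner (ones_mat ?n) ?X = (real ?n)\<^sup>2 / real K"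
    using assms by (simp add: cluster_mat_inner[OF ones] power2_eq_square)
  have "0 \<le> scalar_prod v (?X *\<^sub>v v)" if v: "v \<in> carrier_vec ?n" for v :: "real Matrix.vec"
  proof -
    let ?v = "vec_index v"
    have "scalar_prod v (?X *\<^sub>v v)
      = (\<Sum>i<?n. \<Sum>j<?n. if i div m = j div m then ?v i * ?v j else 0)"
      unfolding quadratic_form_eq[OF cluster_mat_carrier v]
      by (intro sum.cong refl) (simp add: cluster_mat_index)
    also have "\<dots> = (\<Sum>k<K. (\<Sum>i\<in>blk m k. ?v i) * (\<Sum>j\<in>blk m k. ?v j))"
      by (simp add: sum_same_block sum_product)
    finally show ?thesis by (simp add: sum_nonneg)
  qed
  then have "psd_mat ?n ?X" using sym cluster_mat_carrier by (simp add: psd_mat_def)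
  then show ?thesis
    using sym inner cluster_mat_carrier by (auto simp: sdp_feasible_def cluster_mat_index)
qed

lemma sdp_solutions_cluster_mat:
  fixes A :: "real mat" and m K :: nat
  assumes m: "m > 0" and K: "K > 0"
    and A: "A \<in> carrier_mat (m * K) (m * K)" "symmetric_mat A"
    and between: "\<And>k l i j. \<lbrakk>k < K; l < K; k \<noteq> l; i \<in> blk m k; j \<in> blk m l\<rbrakk>
      \<Longrightarrow> (\<Sum>j\<in>blk m l. A $$ (i, j)) / m + (\<Sum>i\<in>blk m k. A $$ (j, i)) / m
        - (\<Sum>i\<in>blk m k. \<Sum>j\<in>blk m l. A $$ (i, j)) / m^2 \<le> \<mu>"
    and within: "\<And>u. \<lbrakk>\<And>k. k < K \<Longrightarrow> (\<Sum>i\<in>blk m k. u i) = 0; \<exists>i<m*K. u i \<noteq> 0\<rbrakk>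
      \<Longrightarrow> (\<Sum>i<m*K. \<Sum>j<m*K. A $$ (i, j) * u i * u j)
        < (\<Sum>i<m*K. ((\<Sum>j\<in>blk m (i div m). A $$ (i, j)) - \<mu> * m) * (u i)\<^sup>2)"
  shows "sdp_solutions (m * K) K A = {cluster_mat m K}"
proof -
  let ?n = "m * K" and ?X = "cluster_mat m K"
  have asym: "A $$ (i, j) = A $$ (j, i)" if "i < ?n" "j < ?n" for i j
    using A that by (simp add: symmetric_mat_iff)
  have cert: "mat_inner A X \<le> mat_inner A ?X"
    "mat_inner A X = mat_inner A ?X \<Longrightarrow> X = ?X"
    if "X \<in> sdp_feasible ?n K" for X
  proof -
    have X: "X \<in> carrier_mat ?n ?n" "psd_mat ?n X" "symmetric_mat X"
      "mat_inner (ones_mat ?n) X = (real ?n)\<^sup>2 / real K"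
      "\<And>i. i < ?n \<Longrightarrow> X $$ (i, i) = 1"
      "\<And>i j. i < ?n \<Longrightarrow> j < ?n \<Longrightarrow> 0 \<le> X $$ (i, j)"
      using that by (auto simp: sdp_feasible_def)
    have xsym: "X $$ (i, j) = X $$ (j, i)" if "i < ?n" "j < ?n" for i j
      using X(1,3) that by (simp add: symmetric_mat_iff)
    have inner: "mat_inner B X = (\<Sum>i<?n. \<Sum>j<?n. B $$ (i, j) * X $$ (i, j))"
      if "B \<in> carrier_mat ?n ?n" for B
      unfolding mat_inner_eq[OF that X(1)]
      by (intro sum.cong refl) (use xsym in auto)
    have "(\<Sum>i<?n. \<Sum>j<?n. X $$ (i, j)) = mat_inner (ones_mat ?n) X"
      by (subst inner) (auto simp: ones_mat_def intro!: sum.cong)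
    then have xsum: "(\<Sum>i<?n. \<Sum>j<?n. X $$ (i, j)) = real K * (real m)\<^sup>2"
      using K X(4) by (simp add: power2_eq_square field_simps)
    note C = sdp_certificate[where a = "\<lambda>i j. A $$ (i, j)" and x = "\<lambda>i j. X $$ (i, j)",
        OF m asym between within xsym psd_mat_quadratic_form[OF X(2)] X(5,6) xsum]
    show "mat_inner A X \<le> mat_inner A ?X"
      unfolding inner[OF A(1)] cluster_mat_inner[OF A(1)] using C(1) by blast
    assume "mat_inner A X = mat_inner A ?X"
    then have "\<forall>i<?n. \<forall>j<?n. X $$ (i, j) = (if i div m = j div m then 1 else 0)"
      unfolding inner[OF A(1)] cluster_mat_inner[OF A(1)] using C(2) by blast
    then show "X = ?X"
      using X(1) carrier_matD[OF cluster_mat_carrier[where m = m and K = K]]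
      by (intro eq_matI) (auto simp: cluster_mat_index)
  qed
  show ?thesis
  proof (intro equalityI subsetI)
    fix X assume "X \<in> sdp_solutions ?n K A"
    then have "X \<in> sdp_feasible ?n K" "mat_inner A ?X \<le> mat_inner A X"
      using cluster_mat_feasible[OF m K] by (auto simp: sdp_solutions_def)
    with cert show "X \<in> {?X}" by (auto intro: order_antisym)
  next
    fix X assume "X \<in> {?X}"
    then show "X \<in> sdp_solutions ?n K A"
      using cert(1) cluster_mat_feasible[OF m K] by (auto simp: sdp_solutions_def)
  qed
qed

text \<open>Feasible matrices have unit diagonal, so changing the diagonal of the input shifts the
  objective by a constant. This is what permits replacing an arbitrary, even random, diagonal by
  zero.\<close>

lemma sdp_solutions_cong_diagonal:
  assumes "A \<in> carrier_mat n n" "B \<in> carrier_mat n n"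
    and "\<And>i j. \<lbrakk>i < n; j < n; i \<noteq> j\<rbrakk> \<Longrightarrow> A $$ (i, j) = B $$ (i, j)"
  shows "sdp_solutions n K A = sdp_solutions n K B"
proof -
  have "mat_inner A X = mat_inner B X + (\<Sum>i<n. A $$ (i, i) - B $$ (i, i))"
    if "X \<in> sdp_feasible n K" for X
  proof -
    have X: "X \<in> carrier_mat n n" "\<And>i. i < n \<Longrightarrow> X $$ (i, i) = 1"
      using that by (auto simp: sdp_feasible_def)
    have "mat_inner A X = (\<Sum>i<n. \<Sum>j<n. B $$ (i, j) * X $$ (j, i)
        + (if i = j then A $$ (i, i) - B $$ (i, i) else 0))"
      unfolding mat_inner_eq[OF assms(1) X(1)]
      by (intro sum.cong refl) (use assms(3) X(2) in auto)
    then show ?thesis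
      by (simp add: sum.distrib mat_inner_eq[OF assms(2) X(1)])
  qed
  then show ?thesis by (auto simp: sdp_solutions_def)
qed

section \<open>Operator norm and Chernoff bounds\<close>

lemma euclidean_norm_vec_L2_set:
  "v \<in> carrier_vec n \<Longrightarrow> euclidean_norm_vec v = L2_set (vec_index v) {..<n}"
  by (auto simp: euclidean_norm_vec_def L2_set_def scalar_prod_def power2_eq_square atLeast0LessThan)

text \<open>The real supremum is an upper bound only once the set is known to be bounded; the sum of
  all absolute entries is a sufficient crude bound.\<close>

lemma euclidean_norm_le_op_norm:
  assumes X: "X \<in> carrier_mat n n" and v: "v \<in> carrier_vec n" "euclidean_norm_vec v \<le> 1"
  shows "euclidean_norm_vec (X *\<^sub>v v) \<le> op_norm_mat X"
proof -
  have "euclidean_norm_vec (X *\<^sub>v w) \<le> (\<Sum>i<n. \<Sum>j<n. \<bar>X $$ (i, j)\<bar>)"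
    if w: "w \<in> carrier_vec n" "euclidean_norm_vec w \<le> 1" for w
  proof -
    have w1: "\<bar>vec_index w j\<bar> \<le> 1" if "j < n" for j
    proof -
      have "\<bar>vec_index w j\<bar> \<le> L2_set (\<lambda>j. \<bar>vec_index w j\<bar>) {..<n}"
        using that by (intro member_le_L2_set) auto
      also have "\<dots> = euclidean_norm_vec w"
        unfolding euclidean_norm_vec_L2_set[OF w(1)] by (simp add: L2_set_def)
      finally show ?thesis using w(2) by simp
    qed
    have Xw: "X *\<^sub>v w \<in> carrier_vec n" using X w(1) by (rule mult_mat_vec_carrier)
    have "\<bar>vec_index (X *\<^sub>v w) i\<bar> \<le> (\<Sum>j<n. \<bar>X $$ (i, j)\<bar>)" if "i < n" for i
    proof -
      have "vec_index (X *\<^sub>v w) i = (\<Sum>j<n. X $$ (i, j) * vec_index w j)"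
        using X w(1) that by (simp add: scalar_prod_def atLeast0LessThan)
      also have "\<bar>\<dots>\<bar> \<le> (\<Sum>j<n. \<bar>X $$ (i, j) * vec_index w j\<bar>)" by (rule sum_abs)
      also have "\<dots> \<le> (\<Sum>j<n. \<bar>X $$ (i, j)\<bar>)"
        by (intro sum_mono) (simp add: abs_mult mult_left_le w1)
      finally show ?thesis .
    qed
    then have "(\<Sum>i<n. \<bar>vec_index (X *\<^sub>v w) i\<bar>) \<le> (\<Sum>i<n. \<Sum>j<n. \<bar>X $$ (i, j)\<bar>)"
      by (intro sum_mono) simp
    then show ?thesis
      using L2_set_le_sum_abs[of "vec_index (X *\<^sub>v w)" "{..<n}"]
      by (simp add: euclidean_norm_vec_L2_set[OF Xw])
  qed
  then have "bdd_above ((\<lambda>v. euclidean_norm_vec (X *\<^sub>v v))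
      ` {v \<in> carrier_vec (dim_col X). euclidean_norm_vec v \<le> 1})"
    using X by (intro bdd_aboveI) auto
  then show ?thesis
    unfolding op_norm_mat_def using X v by (intro cSUP_upper) auto
qed

lemma quadratic_form_le_op_norm:
  assumes X: "X \<in> carrier_mat n n"
  shows "(\<Sum>i<n. \<Sum>j<n. X $$ (i, j) * v i * v j) \<le> op_norm_mat X * (\<Sum>i<n. (v i)\<^sup>2)"
proof -
  define s where "s = L2_set v {..<n}"
  have s2: "s\<^sup>2 = (\<Sum>i<n. (v i)\<^sup>2)" by (simp add: s_def L2_set_def sum_nonneg)
  show ?thesis
  proof (cases "s = 0")
    case True
    then have "\<forall>i<n. v i = 0" using s2 by (simp add: sum_nonneg_eq_0_iff)
    then show ?thesis by simp
  next
    case False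
    define y where "y = Matrix.vec n (\<lambda>i. v i / s)"
    have y: "y \<in> carrier_vec n" by (simp add: y_def)
    have Xy: "X *\<^sub>v y \<in> carrier_vec n" using X y by (rule mult_mat_vec_carrier)
    have "(\<Sum>i<n. (v i / s)\<^sup>2) = 1"
      using False by (simp add: power_divide sum_divide_distrib[symmetric] s2[symmetric])
    moreover have "euclidean_norm_vec y = L2_set (\<lambda>i. v i / s) {..<n}"
      unfolding euclidean_norm_vec_L2_set[OF y] by (intro L2_set_cong) (auto simp: y_def)
    ultimately have norm_y: "euclidean_norm_vec y = 1" by (simp add: L2_set_def)
    have scale: "(\<Sum>i<n. \<Sum>j<n. X $$ (i, j) * v i * v j) = s\<^sup>2 * scalar_prod y (X *\<^sub>v y)"
      unfolding quadratic_form_eq[OF X y] sum_distrib_left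
      by (intro sum.cong refl) (use False in \<open>simp add: y_def power2_eq_square\<close>)
    have "scalar_prod y (X *\<^sub>v y) = (\<Sum>i<n. vec_index y i * vec_index (X *\<^sub>v y) i)"
      using X by (simp add: scalar_prod_def atLeast0LessThan)
    also have "\<dots> \<le> (\<Sum>i<n. \<bar>vec_index y i\<bar> * \<bar>vec_index (X *\<^sub>v y) i\<bar>)"
      by (intro sum_mono) (metis abs_ge_self abs_mult)
    also have "\<dots> \<le> euclidean_norm_vec y * euclidean_norm_vec (X *\<^sub>v y)"
      unfolding euclidean_norm_vec_L2_set[OF y] euclidean_norm_vec_L2_set[OF Xy]
      by (rule L2_set_mult_ineq)
    also have "\<dots> \<le> op_norm_mat X"
      using euclidean_norm_le_op_norm[OF X y] by (simp add: norm_y)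
    finally have "s\<^sup>2 * scalar_prod y (X *\<^sub>v y) \<le> s\<^sup>2 * op_norm_mat X" by (simp add: mult_left_mono)
    then show ?thesis unfolding scale by (simp add: s2 mult.commute)
  qed
qed

section \<open>Chernoff bounds for sums of Bernoulli variables\<close>

lemma finite_set_Pi_pmf_bool:
  fixes p :: "'a \<Rightarrow> bool pmf"
  shows "finite J \<Longrightarrow> finite (set_pmf (Pi_pmf J d p))"
  by (rule finite_subset[OF set_Pi_pmf_subset' finite_PiE_dflt]) auto

lemma bernoulli_sum_mgf_bound:
  fixes s :: "'a \<Rightarrow> real" and l t :: real
  assumes J: "finite J" and T: "T \<subseteq> J" and s: "\<And>e. e \<in> T \<Longrightarrow> s e = t" and t: "0 \<le> t" "t \<le> 1"
  shows "measure_pmf.expectation (Pi_pmf J False (\<lambda>e. bernoulli_pmf (s e)))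
      (\<lambda>x. exp (l * (\<Sum>e\<in>T. of_bool (x e)))) \<le> exp (t * card T * (exp l - 1))"
proof -
  \<comment> \<open>Padding with the factor 1 outside \<open>T\<close> turns the exponential into a
    product over all of \<open>J\<close>, to which independence applies.\<close>
  define f :: "'a \<Rightarrow> bool \<Rightarrow> real" where "f e b = (if e \<in> T then exp (l * of_bool b) else 1)" for e b
  have T_fin: "finite T" using J T by (rule finite_subset[rotated])
  have "exp (l * (\<Sum>e\<in>T. of_bool (x e))) = (\<Prod>e\<in>J. f e (x e))" for x
  proof -
    have "exp (l * (\<Sum>e\<in>T. of_bool (x e))) = (\<Prod>e\<in>T. exp (l * of_bool (x e)))"
      unfolding sum_distrib_left by (rule exp_sum[OF T_fin])
    also have "\<dots> = (\<Prod>e\<in>J. f e (x e))"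
      using J T by (simp add: f_def prod.If_cases Int_absorb1)
    finally show ?thesis .
  qed
  then have "measure_pmf.expectation (Pi_pmf J False (\<lambda>e. bernoulli_pmf (s e)))
      (\<lambda>x. exp (l * (\<Sum>e\<in>T. of_bool (x e))))
    = (\<Prod>e\<in>J. measure_pmf.expectation (bernoulli_pmf (s e)) (f e))"
    by (simp, subst expectation_prod_Pi_pmf[OF J])
      (auto simp: f_def intro!: integrable_measure_pmf_finite)
  also have "\<dots> = (\<Prod>e\<in>J. if e \<in> T then 1 + t * (exp l - 1) else 1)"
  proof (intro prod.cong refl)
    fix e assume "e \<in> J"
    show "measure_pmf.expectation (bernoulli_pmf (s e)) (f e) = (if e \<in> T then 1 + t * (exp l - 1) else 1)"
    proof (cases "e \<in> T")
      case True
      then show ?thesis using s t by (simp add: f_def algebra_simps)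
    next
      case False
      then have "f e = (\<lambda>_. 1)" by (simp add: f_def fun_eq_iff)
      with False show ?thesis by simp
    qed
  qed
  also have "\<dots> = (1 + t * (exp l - 1)) ^ card T"
    using J T by (simp add: prod.If_cases Int_absorb1)
  also have "\<dots> \<le> exp (t * (exp l - 1)) ^ card T"
  proof (rule power_mono)
    have "0 \<le> (1 - t) + t * exp l" using t by simp
    then show "0 \<le> 1 + t * (exp l - 1)" by (simp add: algebra_simps)
  qed (rule exp_ge_add_one_self)
  also have "\<dots> = exp (t * card T * (exp l - 1))"
    by (simp add: exp_of_nat_mult[symmetric] algebra_simps)
  finally show ?thesis .
qed

text \<open>Markov's inequality for the exponential moment. Keeping \<open>l\<close> on both sides
  of the event lets one statement serve both tails, according to the sign of
  \<open>l\<close>.\<close>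

lemma bernoulli_sum_chernoff:
  fixes s :: "'a \<Rightarrow> real" and l t b :: real
  assumes J: "finite J" and T: "T \<subseteq> J" and s: "\<And>e. e \<in> T \<Longrightarrow> s e = t" and t: "0 \<le> t" "t \<le> 1"
  shows "measure_pmf.prob (Pi_pmf J False (\<lambda>e. bernoulli_pmf (s e)))
      {x. l * b \<le> l * (\<Sum>e\<in>T. of_bool (x e))} \<le> exp (t * card T * (exp l - 1) - l * b)"
proof -
  let ?P = "Pi_pmf J False (\<lambda>e. bernoulli_pmf (s e))"
  let ?E = "{x. l * b \<le> l * (\<Sum>e\<in>T. of_bool (x e))}"
  have fin: "finite (set_pmf ?P)" by (rule finite_set_Pi_pmf_bool[OF J])
  have "measure_pmf.prob ?P ?E = measure_pmf.expectation ?P (indicator ?E)" by simp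
  also have "\<dots> \<le> measure_pmf.expectation ?P
      (\<lambda>x. exp (l * (\<Sum>e\<in>T. of_bool (x e))) / exp (l * b))"
    by (intro integral_mono integrable_measure_pmf_finite[OF fin])
      (auto simp: indicator_def)
  also have "\<dots> \<le> exp (t * card T * (exp l - 1)) / exp (l * b)"
    using bernoulli_sum_mgf_bound[where l = l, OF J T s t] by (simp add: divide_right_mono)
  finally show ?thesis by (simp add: exp_diff)
qed

text \<open>Two regimes. For \<open>w\<close> up to the mean, \<open>l = sqrt (w / \<mu>)\<close> is
  at most 1 and exp l <= 1 + l + l^2 yields the square-root term. For larger \<open>w\<close>,
  \<open>l = 1\<close> suffices, the summand \<open>w\<close> doing the work; there e <= 3 and \<mu>
  <= sqrt(w \<mu>).\<close>

lemma bernoulli_sum_upper_tail: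
  fixes s :: "'a \<Rightarrow> real" and t w :: real
  assumes J: "finite J" and T: "T \<subseteq> J" and s: "\<And>e. e \<in> T \<Longrightarrow> s e = t" and t: "0 \<le> t" "t \<le> 1"
    and w: "0 \<le> w"
  shows "measure_pmf.prob (Pi_pmf J False (\<lambda>e. bernoulli_pmf (s e)))
      {x. t * card T + 2 * sqrt (w * (t * card T)) + w < (\<Sum>e\<in>T. of_bool (x e))} \<le> exp (- w)"
proof -
  let ?P = "Pi_pmf J False (\<lambda>e. bernoulli_pmf (s e))"
  define \<mu> where "\<mu> = t * card T"
  define b where "b = \<mu> + 2 * sqrt (w * \<mu>) + w"
  have \<mu>: "0 \<le> \<mu>" using t by (simp add: \<mu>_def)
  have *: "measure_pmf.prob ?P {x. b < (\<Sum>e\<in>T. of_bool (x e))} \<le> exp (\<mu> * (exp l - 1) - l * b)"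
    if "l \<ge> 0" for l
  proof -
    have "measure_pmf.prob ?P {x. b < (\<Sum>e\<in>T. of_bool (x e))}
      \<le> measure_pmf.prob ?P {x. l * b \<le> l * (\<Sum>e\<in>T. of_bool (x e))}"
      using that by (intro measure_pmf.finite_measure_mono) (auto intro!: mult_left_mono)
    also have "\<dots> \<le> exp (\<mu> * (exp l - 1) - l * b)"
      unfolding \<mu>_def by (rule bernoulli_sum_chernoff[OF J T s t])
    finally show ?thesis .
  qed
  have "\<exists>l\<ge>0. \<mu> * (exp l - 1) - l * b \<le> - w"
  proof (cases "w \<le> \<mu>")
    case True
    show ?thesis
    proof (cases "\<mu> = 0")
      case True
      with \<open>w \<le> \<mu>\<close> w show ?thesis by (intro exI[of _ 0]) simp
    next
      case False
      define l where "l = sqrt (w / \<mu>)"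
      have l: "0 \<le> l" "l \<le> 1" using True False \<mu> w by (auto simp: l_def)
      have 1: "\<mu> * l\<^sup>2 = w" using False \<mu> w by (simp add: l_def)
      have "l * sqrt (w * \<mu>) = sqrt (w * w)"
        unfolding l_def real_sqrt_mult[symmetric] using False by simp
      then have 2: "l * sqrt (w * \<mu>) = w" using w by simp
      have "\<mu> * (exp l - 1) \<le> \<mu> * (l + l\<^sup>2)"
        using exp_bound[OF l] \<mu> by (intro mult_left_mono) auto
      then have "\<mu> * (exp l - 1) - l * b \<le> \<mu> * l\<^sup>2 - 2 * (l * sqrt (w * \<mu>)) - l * w"
        by (simp add: b_def algebra_simps)
      also have "\<dots> \<le> - w" using 1 2 l w by simp
      finally show ?thesis using l by blast
    qed
  next
    case False
    have "\<mu> * \<mu> \<le> w * \<mu>" using False \<mu> by (intro mult_right_mono) auto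
    then have "\<mu> \<le> sqrt (w * \<mu>)" using \<mu> by (intro real_le_rsqrt) (simp add: power2_eq_square)
    moreover have "\<mu> * exp 1 \<le> \<mu> * 3" using exp_le \<mu> by (intro mult_left_mono) auto
    ultimately show ?thesis using \<mu> by (intro exI[of _ 1]) (simp add: b_def algebra_simps)
  qed
  then obtain l where "l \<ge> 0" "\<mu> * (exp l - 1) - l * b \<le> - w" by blast
  with *[of l] show ?thesis
    unfolding b_def \<mu>_def[symmetric] by (meson exp_le_cancel_iff order_trans)
qed

text \<open>No linear term appears, since exp(-l) <= 1 - l + l^2/2 holds for every l >= 0 and the
  optimal \<open>l\<close> can be used in all regimes.\<close>

lemma bernoulli_sum_lower_tail:
  fixes s :: "'a \<Rightarrow> real" and t w :: real
  assumes J: "finite J" and T: "T \<subseteq> J" and s: "\<And>e. e \<in> T \<Longrightarrow> s e = t" and t: "0 \<le> t" "t \<le> 1"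
    and w: "0 \<le> w"
  shows "measure_pmf.prob (Pi_pmf J False (\<lambda>e. bernoulli_pmf (s e)))
      {x. (\<Sum>e\<in>T. of_bool (x e)) < t * card T - sqrt (2 * w * (t * card T))} \<le> exp (- w)"
proof -
  let ?P = "Pi_pmf J False (\<lambda>e. bernoulli_pmf (s e))"
  define \<mu> where "\<mu> = t * card T"
  define b where "b = \<mu> - sqrt (2 * w * \<mu>)"
  have \<mu>: "0 \<le> \<mu>" using t by (simp add: \<mu>_def)
  have "measure_pmf.prob ?P {x. (\<Sum>e\<in>T. of_bool (x e)) < b} \<le> exp (- w)"
  proof (cases "\<mu> = 0")
    case True
    have "{x. (\<Sum>e\<in>T. of_bool (x e)) < b} = {}"
      using True by (auto simp: b_def not_less sum_nonneg)
    then show ?thesis by simp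
  next
    case False
    define l where "l = sqrt (2 * w / \<mu>)"
    have l: "0 \<le> l" using \<mu> w by (simp add: l_def)
    have 1: "\<mu> * l\<^sup>2 = 2 * w" using False \<mu> w by (simp add: l_def)
    have "l * sqrt (2 * w * \<mu>) = sqrt ((2 * w)\<^sup>2)"
      unfolding l_def real_sqrt_mult[symmetric] using False by (simp add: power2_eq_square)
    also have "\<dots> = 2 * w" using w by (intro real_sqrt_unique) auto
    finally have 2: "l * sqrt (2 * w * \<mu>) = 2 * w" .
    \<comment> \<open>This product is (1 + l^2/2)^2 - l^2 = 1 + l^4/4, so the lower Taylor bound on
      exp l inverts to an upper bound on exp(-l).\<close>
    have "1 \<le> (1 + l + l\<^sup>2 / 2) * (1 - l + l\<^sup>2 / 2)"
    proof -
      have "(1 + l + l\<^sup>2 / 2) * (1 - l + l\<^sup>2 / 2) = 1 + l^4 / 4"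
        by (simp add: field_simps power2_eq_square power4_eq_xxxx)
      then show ?thesis by simp
    qed
    moreover have "0 \<le> 1 - l + l\<^sup>2 / 2"
      using zero_le_power2[of "l - 1"] by (simp add: power2_eq_square algebra_simps)
    ultimately have "1 \<le> exp l * (1 - l + l\<^sup>2 / 2)"
      using mult_right_mono[OF exp_lower_Taylor_quadratic[OF l]] order_trans by blast
    then have exp: "exp (- l) \<le> 1 - l + l\<^sup>2 / 2" by (simp add: exp_minus inverse_eq_divide pos_divide_le_eq mult.commute)
    have "measure_pmf.prob ?P {x. (\<Sum>e\<in>T. of_bool (x e)) < b}
      \<le> measure_pmf.prob ?P {x. - l * b \<le> - l * (\<Sum>e\<in>T. of_bool (x e))}"
      using l by (intro measure_pmf.finite_measure_mono) (auto intro!: mult_left_mono)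
    also have "\<dots> \<le> exp (\<mu> * (exp (- l) - 1) - (- l) * b)"
      unfolding \<mu>_def by (rule bernoulli_sum_chernoff[OF J T s t])
    also have "\<dots> \<le> exp (\<mu> * (- l + l\<^sup>2 / 2) + l * b)"
    proof -
      have "\<mu> * (exp (- l) - 1) \<le> \<mu> * (- l + l\<^sup>2 / 2)" using exp \<mu> by (intro mult_left_mono) auto
      then show ?thesis by simp
    qed
    also have "\<mu> * (- l + l\<^sup>2 / 2) + l * b = \<mu> * l\<^sup>2 / 2 - l * sqrt (2 * w * \<mu>)"
      by (simp add: b_def algebra_simps)
    also have "\<dots> = - w" using 1 2 by simp
    finally show ?thesis .
  qed
  then show ?thesis unfolding b_def \<mu>_def .
qed

section \<open>Independent binary entries\<close>

text \<open>After pulling back along \<open>F\<close>, \<open>X i\<close> reads only the coordinate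
  \<open>e i\<close>, and injectivity makes different \<open>i\<close> read different coordinates.
  Needed because the concentration property asks for independence under the law of the matrix
  itself.\<close>

lemma indep_vars_map_Pi_pmf:
  fixes X :: "'i \<Rightarrow> 'b \<Rightarrow> real" and g :: "'i \<Rightarrow> bool \<Rightarrow> real"
  assumes J: "finite J" and I: "finite I" "inj_on e I" "e ` I \<subseteq> J"
    and X: "\<And>i x. i \<in> I \<Longrightarrow> X i (F x) = g i (x (e i))"
  shows "prob_space.indep_vars (measure_pmf (map_pmf F (Pi_pmf J False p))) (\<lambda>_. borel) X I"
proof (cases "I = {}")
  case True
  then show ?thesis
    by (simp add: prob_space.indep_vars_def2[OF measure_pmf.prob_space_axioms]
      prob_space.indep_sets_def[OF measure_pmf.prob_space_axioms])
next
  case False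
  let ?P = "Pi_pmf J False p"
  have comp: "measure_pmf.prob ?P (\<Inter>i\<in>K. {x. g i (x (e i)) \<in> A i})
      = (\<Prod>i\<in>K. measure_pmf.prob ?P {x. g i (x (e i)) \<in> A i})"
    if K: "K \<subseteq> I" "K \<noteq> {}" for A and K :: "'i set"
  proof -
    \<comment> \<open>The target events indexed by coordinates instead of by \<open>i\<close>;
      \<open>inv_into\<close> recovers the index, which is sound by injectivity.\<close>
    define B where "B j = (\<lambda>i. {b. g i b \<in> A i}) (inv_into I e j)" for j
    have B: "B (e i) = {b. g i b \<in> A i}" if "i \<in> I" for i
      using that I(2) by (simp add: B_def)
    have "measure_pmf.prob ?P (\<Inter>j\<in>e ` K. (\<lambda>x. x j) -` B j \<inter> space (measure_pmf ?P))
        = (\<Prod>j\<in>e ` K. measure_pmf.prob ?P ((\<lambda>x. x j) -` B j \<inter> space (measure_pmf ?P)))"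
      using K I finite_subset[OF K(1)]
      by (intro prob_space.indep_varsD[OF measure_pmf.prob_space_axioms indep_vars_Pi_pmf[OF J]]) auto
    also have "\<dots> = (\<Prod>i\<in>K. measure_pmf.prob ?P ((\<lambda>x. x (e i)) -` B (e i)))"
      using I(2) K(1) by (subst prod.reindex) (auto intro: inj_on_subset)
    also have "\<dots> = (\<Prod>i\<in>K. measure_pmf.prob ?P {x. g i (x (e i)) \<in> A i})"
      by (intro prod.cong refl arg_cong[where f = "measure_pmf.prob ?P"]) (use K B in auto)
    also have "(\<Inter>j\<in>e ` K. (\<lambda>x. x j) -` B j \<inter> space (measure_pmf ?P))
        = (\<Inter>i\<in>K. {x. g i (x (e i)) \<in> A i})"
      unfolding image_image by (intro INF_cong refl) (use K B in auto)
    finally show ?thesis .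
  qed
  show ?thesis
  proof (subst prob_space.indep_vars_finite[OF measure_pmf.prob_space_axioms False I(1), where E = "\<lambda>_. sets borel"])
    show "\<forall>A\<in>I \<rightarrow> sets borel. measure_pmf.prob (map_pmf F ?P)
          (\<Inter>j\<in>I. X j -` A j \<inter> space (measure_pmf (map_pmf F ?P))) =
        (\<Prod>j\<in>I. measure_pmf.prob (map_pmf F ?P) (X j -` A j \<inter> space (measure_pmf (map_pmf F ?P))))"
    proof
      fix A :: "'i \<Rightarrow> real set"
      have 1: "F -` (\<Inter>j\<in>I. X j -` A j) = (\<Inter>i\<in>I. {x. g i (x (e i)) \<in> A i})"
        using X by auto
      have 2: "F -` X j -` A j = {x. g j (x (e j)) \<in> A j}" if "j \<in> I" for j
        using X that by auto
      show "measure_pmf.prob (map_pmf F ?P)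
          (\<Inter>j\<in>I. X j -` A j \<inter> space (measure_pmf (map_pmf F ?P))) =
        (\<Prod>j\<in>I. measure_pmf.prob (map_pmf F ?P) (X j -` A j \<inter> space (measure_pmf (map_pmf F ?P))))"
        using comp[OF subset_refl False, of A] by (simp add: 1 2 cong: prod.cong)
    qed
  qed (use sets.sigma_sets_eq[of "borel :: real measure"] in \<open>auto simp: sets.Int_stable\<close>)
qed

lemma expectation_Pi_pmf_bernoulli:
  fixes f :: "bool \<Rightarrow> real" and s :: "'a \<Rightarrow> real"
  assumes "finite J" "j \<in> J" "0 \<le> s j" "s j \<le> 1"
  shows "measure_pmf.expectation (Pi_pmf J False (\<lambda>e. bernoulli_pmf (s e))) (\<lambda>x. f (x j))
    = s j * f True + (1 - s j) * f False"
proof -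
  have "measure_pmf.expectation (Pi_pmf J False (\<lambda>e. bernoulli_pmf (s e))) (\<lambda>x. f (x j))
    = measure_pmf.expectation (map_pmf (\<lambda>x. x j) (Pi_pmf J False (\<lambda>e. bernoulli_pmf (s e)))) f"
    by simp
  also have "\<dots> = measure_pmf.expectation (bernoulli_pmf (s j)) f"
    using assms by (subst Pi_pmf_component) simp_all
  also have "\<dots> = s j * f True + (1 - s j) * f False"
    using assms by simp
  finally show ?thesis .
qed

text \<open>The mask \<open>z\<close> switches entries off and \<open>e\<close> names the Boolean
  behind each lower-triangular entry, so one statement covers a diagonal block and the off-diagonal
  part. A masked entry is the constant 0: still independent, with variance 0. Reading entry (i,j) at
  (max, min) makes the matrix symmetric.\<close>

lemma masked_concentration:
  fixes s :: "'a \<Rightarrow> real" and e :: "nat \<times> nat \<Rightarrow> 'a" and z :: "nat \<times> nat \<Rightarrow> bool"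
  assumes CC: "concentration_constants C C' c r"
    and N: "N \<ge> 1" and \<sigma>: "\<sigma> \<ge> 0" "real N * \<sigma>\<^sup>2 \<ge> C' * ln (real N)"
    and J: "finite J" and e: "inj_on e {(i, j). j \<le> i \<and> i < N}" "e ` {(i, j). j \<le> i \<and> i < N} \<subseteq> J"
    and z: "\<And>i. \<not> z (i, i)"
    and s: "\<And>i j. \<lbrakk>z (i, j); j \<le> i; i < N\<rbrakk> \<Longrightarrow> 0 \<le> s (e (i, j)) \<and> s (e (i, j)) \<le> 1 \<and> s (e (i, j)) \<le> \<sigma>\<^sup>2"
  shows "measure_pmf.prob (Pi_pmf J False (\<lambda>e. bernoulli_pmf (s e)))
      {x. \<not> op_norm_mat (Matrix.mat N N (\<lambda>(i, j). if z (max i j, min i j)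
          then of_bool (x (e (max i j, min i j))) - s (e (max i j, min i j)) else 0))
        \<le> C * \<sigma> * sqrt (real N)} \<le> c * real N powr (- r)"
proof -
  let ?P = "Pi_pmf J False (\<lambda>e. bernoulli_pmf (s e))"
  define u where "u i j = (max i j, min i j)" for i j :: nat
  define F :: "('a \<Rightarrow> bool) \<Rightarrow> real mat"
    where "F x = Matrix.mat N N (\<lambda>(i, j). of_bool (z (u i j) \<and> x (e (u i j))))" for x
  let ?\<mu> = "map_pmf F ?P"
  have eJ: "e (u i j) \<in> J" if "i < N" "j < N" for i j
    using e(2) that by (auto simp: u_def)
  have su: "0 \<le> s (e (u i j))" "s (e (u i j)) \<le> 1" "s (e (u i j)) \<le> \<sigma>\<^sup>2"
    if "i < N" "j < N" "z (u i j)" for i j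
    using s[of "max i j" "min i j"] that by (auto simp: u_def)
  have entry: "F x $$ (i, j) = of_bool (z (u i j) \<and> x (e (u i j)))" if "i < N" "j < N" for x i j
    using that by (simp add: F_def)
  have law: "symmetric_binary_law N ?\<mu>"
    unfolding symmetric_binary_law_def
  proof (intro conjI ballI)
    fix B assume "B \<in> set_pmf ?\<mu>"
    then obtain x where B: "B = F x" by auto
    show carr: "B \<in> carrier_mat N N" by (simp add: B F_def)
    show "symmetric_mat B"
      unfolding symmetric_mat_iff[OF carr] by (auto simp: B entry u_def max.commute min.commute)
    show "\<forall>i<N. \<forall>j<N. B $$ (i, j) \<in> {0, 1}" by (auto simp: B entry)
    show "\<forall>i<N. B $$ (i, i) = 0" using z by (auto simp: B entry u_def)
  next
    have fin: "finite {(i::nat, j). j \<le> i \<and> i < N}"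
      by (rule finite_subset[of _ "{..<N} \<times> {..<N}"]) auto
    show "prob_space.indep_vars (measure_pmf ?\<mu>) (\<lambda>_. borel) (\<lambda>(i, j) B. B $$ (i, j))
       {(i, j). j \<le> i \<and> i < N}"
      by (rule indep_vars_map_Pi_pmf[OF J fin e, where g = "\<lambda>p b. of_bool (z p \<and> b)"])
        (auto simp: entry u_def max_def min_def)
  qed
  have mean: "measure_pmf.expectation ?\<mu> (\<lambda>B. B $$ (i, j)) = (if z (u i j) then s (e (u i j)) else 0)"
    if "i < N" "j < N" for i j
  proof (cases "z (u i j)")
    case True
    then show ?thesis
      using expectation_Pi_pmf_bernoulli[where f = of_bool and s = s and j = "e (u i j)", OF J eJ su(1,2)] that
      by (simp add: entry)
  next
    case False
    then show ?thesis using that by (simp add: entry)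
  qed
  have var: "measure_pmf.variance ?\<mu> (\<lambda>B. B $$ (i, j)) \<le> \<sigma>\<^sup>2" if ij: "i < N" "j < N" for i j
  proof (cases "z (u i j)")
    case True
    let ?s = "s (e (u i j))"
    have "measure_pmf.variance ?\<mu> (\<lambda>B. B $$ (i, j))
      = measure_pmf.expectation ?P (\<lambda>x. (of_bool (x (e (u i j))) - ?s)\<^sup>2)"
      unfolding mean[OF ij] using ij True by (simp add: entry)
    also have "\<dots> = ?s * (1 - ?s)\<^sup>2 + (1 - ?s) * ?s\<^sup>2"
      using expectation_Pi_pmf_bernoulli[where f = "\<lambda>b. (of_bool b - ?s)\<^sup>2" and s = s and j = "e (u i j)", OF J eJ su(1,2)] ij True
      by simp
    also have "\<dots> = ?s - ?s\<^sup>2" by (simp add: power2_eq_square algebra_simps)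
    also have "\<dots> \<le> \<sigma>\<^sup>2" using su(3)[OF ij True] zero_le_power2[of ?s] by linarith
    finally show ?thesis .
  next
    case False
    then show ?thesis unfolding mean[OF ij] using ij by (simp add: entry)
  qed
  have "measure_pmf.prob ?\<mu> {B. op_norm_mat (B - mean_mat N ?\<mu>) \<le> C * \<sigma> * sqrt (real N)}
      \<ge> 1 - c * real N powr (- r)"
    using CC law var N \<sigma> unfolding concentration_constants_def by blast
  moreover have "F x - mean_mat N ?\<mu> = Matrix.mat N N (\<lambda>(i, j). if z (max i j, min i j)
          then of_bool (x (e (max i j, min i j))) - s (e (max i j, min i j)) else 0)" for x
    by (intro eq_matI) (auto simp: mean_mat_def mean F_def u_def simp del: integral_map_pmf)
  ultimately have "measure_pmf.prob ?P {x. op_norm_mat (Matrix.mat N N (\<lambda>(i, j). if z (max i j, min i j)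
          then of_bool (x (e (max i j, min i j))) - s (e (max i j, min i j)) else 0))
        \<le> C * \<sigma> * sqrt (real N)} \<ge> 1 - c * real N powr (- r)"
    by (simp add: vimage_def)
  then show ?thesis
    using measure_pmf.prob_compl[where M = ?P, of "{x. op_norm_mat (Matrix.mat N N (\<lambda>(i, j). if z (max i j, min i j)
          then of_bool (x (e (max i j, min i j))) - s (e (max i j, min i j)) else 0))
        \<le> C * \<sigma> * sqrt (real N)}"]
    by (simp add: Collect_neg_eq[symmetric] Compl_eq_Diff_UNIV[symmetric])
qed

text \<open>The event need not be assumed measurable: it is a finite union of events that fix all
  entries. This moves every later computation to a discrete product law.\<close>
lemma (in prob_space) prob_indep_binary_eq_Pi_pmf:
  fixes X :: "'i \<Rightarrow> 'a \<Rightarrow> real" and s :: "'i \<Rightarrow> real"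
  assumes I: "finite I" and indep: "indep_vars (\<lambda>_. borel) X I"
    and bin: "\<And>i \<omega>. i \<in> I \<Longrightarrow> \<omega> \<in> space M \<Longrightarrow> X i \<omega> \<in> {0, 1}"
    and mean: "\<And>i. i \<in> I \<Longrightarrow> expectation (X i) = s i" and s: "\<And>i. i \<in> I \<Longrightarrow> 0 \<le> s i \<and> s i \<le> 1"
  shows "prob {\<omega> \<in> space M. R (\<lambda>i. i \<in> I \<and> X i \<omega> = 1)}
    = measure_pmf.prob (Pi_pmf I False (\<lambda>i. bernoulli_pmf (s i))) {x. R x}"
proof -
  let ?P = "Pi_pmf I False (\<lambda>i. bernoulli_pmf (s i))"
  define g where "g \<omega> i \<longleftrightarrow> i \<in> I \<and> X i \<omega> = 1" for \<omega> i
  define Y where "Y = PiE_dflt I False (\<lambda>_. UNIV :: bool set)"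
  have Y_fin: "finite Y" unfolding Y_def using I by (intro finite_PiE_dflt) auto
  have rv: "random_variable borel (X i)" if "i \<in> I" for i
    using indep that by (auto simp: indep_vars_def2)
  have point: "{\<omega> \<in> space M. g \<omega> = y} \<in> events \<and> prob {\<omega> \<in> space M. g \<omega> = y} = pmf ?P y"
    if y: "y \<in> Y" for y
  proof (cases "I = {}")
    \<comment> \<open>Separate because the intersection over an empty family is \<open>UNIV\<close>,
      not the sample space.\<close>
    case True
    then have "{\<omega> \<in> space M. g \<omega> = y} = space M" "y = (\<lambda>_. False)"
      using y by (auto simp: g_def Y_def PiE_dflt_def)
    then show ?thesis using True by (simp add: prob_space)
  next
    case False
    have ev: "X i -` {of_bool (y i)} \<inter> space M \<in> events" if "i \<in> I" for i
      using rv[OF that] by (rule measurable_sets) simp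
    have eq: "{\<omega> \<in> space M. g \<omega> = y} = (\<Inter>i\<in>I. X i -` {of_bool (y i)} \<inter> space M)"
    proof (intro equalityI subsetI)
      fix \<omega> assume "\<omega> \<in> {\<omega> \<in> space M. g \<omega> = y}"
      then have \<omega>: "\<omega> \<in> space M" "y = g \<omega>" by auto
      then show "\<omega> \<in> (\<Inter>i\<in>I. X i -` {of_bool (y i)} \<inter> space M)"
        using bin[OF _ \<omega>(1)] by (auto simp: g_def)
    next
      fix \<omega> assume \<omega>: "\<omega> \<in> (\<Inter>i\<in>I. X i -` {of_bool (y i)} \<inter> space M)"
      have Xy: "X i \<omega> = of_bool (y i)" "\<omega> \<in> space M" if "i \<in> I" for i
        using INT_D[OF \<omega> that] by auto
      have "g \<omega> i = y i" for i
        using Xy(1)[of i] y by (cases "i \<in> I") (auto simp: g_def Y_def PiE_dflt_def)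
      then show "\<omega> \<in> {\<omega> \<in> space M. g \<omega> = y}" using Xy(2) False by auto
    qed
    have p1: "prob (X i -` {1} \<inter> space M) = s i" if "i \<in> I" for i
    proof -
      have "s i = expectation (indicator (X i -` {1} \<inter> space M))"
        unfolding mean[OF that, symmetric]
        by (intro Bochner_Integration.integral_cong) (use bin[OF that] in \<open>auto simp: indicator_def\<close>)
      also have "\<dots> = prob (X i -` {1} \<inter> space M)"
        using measurable_sets[OF rv[OF that], of "{1}"] by simp
      finally show ?thesis ..
    qed
    have p0: "prob (X i -` {0} \<inter> space M) = 1 - s i" if "i \<in> I" for i
    proof -
      have "X i -` {0} \<inter> space M = space M - (X i -` {1} \<inter> space M)"
        using bin[OF that] by auto
      then show ?thesis
        using prob_compl[OF measurable_sets[OF rv[OF that], of "{1}"]] p1[OF that] by simp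
    qed
    have "prob (\<Inter>i\<in>I. X i -` {of_bool (y i)} \<inter> space M)
      = (\<Prod>i\<in>I. prob (X i -` {of_bool (y i)} \<inter> space M))"
      by (rule indep_varsD_finite[OF indep False I]) simp
    also have "\<dots> = (\<Prod>i\<in>I. pmf (bernoulli_pmf (s i)) (y i))"
      by (intro prod.cong refl) (use p0 p1 s in \<open>auto split: if_splits simp: of_bool_def\<close>)
    also have "\<dots> = pmf ?P y"
      using y by (subst pmf_Pi'[OF I]) (auto simp: Y_def PiE_dflt_def)
    finally have "prob (\<Inter>i\<in>I. X i -` {of_bool (y i)} \<inter> space M) = pmf ?P y" .
    moreover have "(\<Inter>i\<in>I. X i -` {of_bool (y i)} \<inter> space M) \<in> events"
      by (rule sets.finite_INT[OF I False ev])
    ultimately show ?thesis unfolding eq by blast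
  qed
  have "{\<omega> \<in> space M. R (g \<omega>)} = (\<Union>y\<in>Y \<inter> {x. R x}. {\<omega> \<in> space M. g \<omega> = y})"
    by (auto simp: Y_def PiE_dflt_def g_def)
  moreover have "prob (\<Union>y\<in>Y \<inter> {x. R x}. {\<omega> \<in> space M. g \<omega> = y})
      = (\<Sum>y\<in>Y \<inter> {x. R x}. prob {\<omega> \<in> space M. g \<omega> = y})"
    using point Y_fin by (intro finite_measure_finite_Union) (auto simp: disjoint_family_on_def)
  ultimately have "prob {\<omega> \<in> space M. R (g \<omega>)} = (\<Sum>y\<in>Y \<inter> {x. R x}. prob {\<omega> \<in> space M. g \<omega> = y})"
    by simp
  also have "\<dots> = (\<Sum>y\<in>Y \<inter> {x. R x}. pmf ?P y)"
    using point by (intro sum.cong) auto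
  also have "\<dots> = measure_pmf.prob ?P (Y \<inter> {x. R x})"
    using Y_fin by (simp add: measure_measure_pmf_finite)
  also have "\<dots> = measure_pmf.prob ?P ({x. R x} \<inter> set_pmf ?P)"
  proof -
    have "set_pmf ?P \<subseteq> Y"
      using set_Pi_pmf_subset'[OF I, of False "\<lambda>i. bernoulli_pmf (s i)"]
      unfolding Y_def PiE_dflt_def by auto
    then have "Y \<inter> {x. R x} \<inter> set_pmf ?P = {x. R x} \<inter> set_pmf ?P" by auto
    then show ?thesis by (metis measure_Int_set_pmf)
  qed
  finally show ?thesis unfolding g_def by (simp add: measure_Int_set_pmf)
qed

section \<open>Exact recovery under concentration\<close>

text \<open>All rates are in units of \<open>L = log n\<close>, with \<open>P\<close> the rate of
  one block and \<open>a = c\<^sub>2 + 2\<close>. The budget: \<open>D * sqrt P\<close> covers the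
  inner degree fluctuation and \<open>2 * a\<close>, \<open>D * sqrt (q * K)\<close> covers the
  outer fluctuations, and the \<open>C\<close> part is left for the two operator norms.\<close>

lemma signal_dominates_noise:
  fixes C D L P p q c\<^sub>1 a :: real and K :: nat
  assumes C: "C > 0" and K: "K \<ge> 1" and L: "L \<ge> 4" and p: "p > 0" and q: "q \<ge> 0" and P: "P \<ge> p"
    and c1: "c\<^sub>1 > 0" and a: "a > 0"
    and D: "D = max (sqrt (4 * (c\<^sub>1 + 1))) (3 * sqrt (4 * a))"
    and gap: "p - q > (C + D) * (sqrt p + sqrt (q * K))"
  shows "C * sqrt (P * L) + C * sqrt (max (q * K) p * L)
    < (P - sqrt (2 * (c\<^sub>1 + 1) * P) - (q + 6 * sqrt (a * q) + 2 * a)) * L"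
proof -
  define E where "E = C + D"
  have D0: "sqrt (4 * (c\<^sub>1 + 1)) \<le> D" "6 * sqrt a \<le> D" "0 \<le> D"
    using D a c1 by (auto simp: real_sqrt_mult le_max_iff_disj)
  have E: "E > 0" using C D0 by (simp add: E_def)
  have "sqrt p * sqrt p = p" using p by simp
  moreover have "E * sqrt p \<le> E * (sqrt p + sqrt (q * K))"
    using E q by (intro mult_left_mono) auto
  ultimately have "E * sqrt p < sqrt p * sqrt p" using gap q unfolding E_def by linarith
  then have sE: "E < sqrt p" by (rule mult_right_less_imp_less) (use p in simp)
  have sP: "sqrt p \<le> sqrt P" using P by simp
  have PP: "sqrt P * sqrt P = P" using P p by simp
  \<comment> \<open>t - E sqrt t increases once 2 sqrt t >= E, so the gap assumed for the smallest
    rate passes to the rate of every block.\<close>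
  have "0 \<le> (sqrt P - sqrt p) * (sqrt P + sqrt p - E)"
  proof (rule mult_nonneg_nonneg)
    show "0 \<le> sqrt P + sqrt p - E" using sE real_sqrt_ge_zero[of P] P p by linarith
  qed (use P in simp)
  then have "p - E * sqrt p \<le> P - E * sqrt P"
    using PP \<open>sqrt p * sqrt p = p\<close> by (simp add: algebra_simps)
  then have gapP: "P - q > C * (sqrt P + sqrt (q * K)) + D * sqrt P + D * sqrt (q * K)"
    using gap by (simp add: E_def algebra_simps)
  have DP: "sqrt (2 * (c\<^sub>1 + 1) * P) + 2 * a \<le> D * sqrt P"
  proof -
    \<comment> \<open>As 32 <= 36, three quarters of \<open>D\<close> absorb the degree fluctuation.
      The last quarter absorbs \<open>2 * a\<close>, using 36 a <= D^2 and D <= sqrt P.\<close>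
    have "4 * sqrt (2 * (c\<^sub>1 + 1)) \<le> 3 * sqrt (4 * (c\<^sub>1 + 1))"
      by (rule power2_le_imp_le) (use c1 in \<open>simp_all add: power_mult_distrib\<close>)
    then have s: "sqrt (2 * (c\<^sub>1 + 1)) \<le> 3 / 4 * D" using D0(1) by linarith
    have "2 * a \<le> 1 / 4 * D * D"
    proof -
      have "(6 * sqrt a) * (6 * sqrt a) \<le> D * D" using D0 a by (intro mult_mono) auto
      then show ?thesis using a by simp
    qed
    also have "\<dots> \<le> 1 / 4 * D * sqrt P"
    proof (rule mult_left_mono)
      show "D \<le> sqrt P" using sE sP C unfolding E_def by linarith
    qed (use D0 in simp)
    finally have "2 * a \<le> 1 / 4 * D * sqrt P" .
    moreover have "sqrt (2 * (c\<^sub>1 + 1)) * sqrt P \<le> 3 / 4 * D * sqrt P"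
      using s P p by (intro mult_right_mono) auto
    ultimately show ?thesis by (simp add: real_sqrt_mult)
  qed
  have Dq: "6 * sqrt (a * q) \<le> D * sqrt (q * K)"
  proof -
    have "q * 1 \<le> q * K" using K q by (intro mult_left_mono) auto
    then have "6 * sqrt a * sqrt q \<le> D * sqrt (q * K)"
      using D0 q a by (intro mult_mono) auto
    then show ?thesis by (simp add: real_sqrt_mult)
  qed
  have main: "C * (sqrt P + sqrt (q * K)) < P - sqrt (2 * (c\<^sub>1 + 1) * P) - (q + 6 * sqrt (a * q) + 2 * a)"
    using gapP DP Dq by linarith
  have sL: "2 * sqrt L \<le> L"
  proof -
    have "2 \<le> sqrt L" using L by (simp add: real_le_rsqrt)
    then have "2 * sqrt L \<le> sqrt L * sqrt L" using L by (intro mult_right_mono) auto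
    then show ?thesis using L by simp
  qed
  have "sqrt (max (q * K) p) \<le> sqrt P + sqrt (q * K)"
  proof (cases "q * K \<le> p")
    case True
    then have "max (q * K) p = p" by simp
    moreover have "0 \<le> sqrt (q * K)" using q by simp
    ultimately show ?thesis using sP by linarith
  next
    case False
    then have "max (q * K) p = q * K" by simp
    then show ?thesis using p P by simp
  qed
  then have "C * sqrt P * sqrt L + C * sqrt (max (q * K) p) * sqrt L
      \<le> C * sqrt P * sqrt L + C * (sqrt P + sqrt (q * K)) * sqrt L"
    using C L by (intro add_left_mono mult_right_mono mult_left_mono) auto
  also have "\<dots> = C * (sqrt P + (sqrt P + sqrt (q * K))) * sqrt L"
    by (simp add: algebra_simps)
  also have "\<dots> \<le> C * (2 * (sqrt P + sqrt (q * K))) * sqrt L"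
    using C L q by (intro mult_right_mono mult_left_mono) auto
  also have "\<dots> = C * (sqrt P + sqrt (q * K)) * (2 * sqrt L)" by simp
  also have "\<dots> \<le> C * (sqrt P + sqrt (q * K)) * L"
    using sL C P p q by (intro mult_left_mono) auto
  also have "\<dots> < (P - sqrt (2 * (c\<^sub>1 + 1) * P) - (q + 6 * sqrt (a * q) + 2 * a)) * L"
    using main L by (intro mult_strict_right_mono) auto
  finally show ?thesis by (simp only: real_sqrt_mult mult.assoc)
qed

section \<open>Adjacency matrix and centred noise over unordered pairs\<close>

definition edge :: "nat \<Rightarrow> nat \<Rightarrow> nat \<times> nat" where
  "edge i j = (min i j, max i j)"

definition adj_mat :: "nat \<Rightarrow> (nat \<times> nat \<Rightarrow> bool) \<Rightarrow> real mat" where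
  "adj_mat n x = Matrix.mat n n (\<lambda>(i, j). of_bool (i \<noteq> j \<and> x (edge i j)))"

definition edge_prob :: "nat \<Rightarrow> real mat \<Rightarrow> nat \<times> nat \<Rightarrow> real" where
  "edge_prob m \<Psi> e = \<Psi> $$ (fst e div m, snd e div m)"

definition noise :: "nat \<Rightarrow> real mat \<Rightarrow> (nat \<times> nat \<Rightarrow> bool) \<Rightarrow> nat \<Rightarrow> nat \<Rightarrow> real" where
  "noise m \<Psi> x i j = (if i \<noteq> j then of_bool (x (edge i j)) - edge_prob m \<Psi> (edge i j) else 0)"

definition diag_noise_mat :: "nat \<Rightarrow> real mat \<Rightarrow> (nat \<times> nat \<Rightarrow> bool) \<Rightarrow> nat \<Rightarrow> real mat" where
  "diag_noise_mat m \<Psi> x k = Matrix.mat m m (\<lambda>(i, j). noise m \<Psi> x (k * m + i) (k * m + j))"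

definition offdiag_noise_mat :: "nat \<Rightarrow> nat \<Rightarrow> real mat \<Rightarrow> (nat \<times> nat \<Rightarrow> bool) \<Rightarrow> real mat" where
  "offdiag_noise_mat n m \<Psi> x =
     Matrix.mat n n (\<lambda>(i, j). if i div m \<noteq> j div m then noise m \<Psi> x i j else 0)"

lemma edge_commute: "edge i j = edge j i"
  by (simp add: edge_def min.commute max.commute)

lemma inj_on_edge: "inj_on (edge i) S"
  by (auto simp: inj_on_def edge_def min_def max_def split: if_splits)

lemma adj_mat_carrier: "adj_mat n x \<in> carrier_mat n n"
  by (simp add: adj_mat_def)

lemma adj_mat_index: "i < n \<Longrightarrow> j < n \<Longrightarrow> adj_mat n x $$ (i, j) = of_bool (i \<noteq> j \<and> x (edge i j))"
  by (simp add: adj_mat_def)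

lemma symmetric_adj_mat: "symmetric_mat (adj_mat n x)"
  unfolding symmetric_mat_iff[OF adj_mat_carrier] by (auto simp: adj_mat_index edge_commute)

lemma edge_prob_edge:
  assumes "\<Psi> \<in> carrier_mat K K" "symmetric_mat \<Psi>" "i < m * K" "j < m * K"
  shows "edge_prob m \<Psi> (edge i j) = \<Psi> $$ (i div m, j div m)"
  using assms div_less_blocks[OF assms(3)] div_less_blocks[OF assms(4)]
  by (auto simp: edge_prob_def edge_def symmetric_mat_iff min_def max_def)

lemma sum_blk_shift: "(\<Sum>i\<in>blk m k. f i) = (\<Sum>i<m. f (k * m + i))"
  unfolding blk_def
  by (rule sum.reindex_bij_witness[of _ "\<lambda>i. k * m + i" "\<lambda>i. i - k * m"]) auto

text \<open>Splitting off the diagonal blocks gives each its own bound \<open>b k\<close>, of order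
  sqrt(p_k m), to be compared with the degrees inside the same block; a single norm for all of A
  would not scale with the block.\<close>

lemma noise_quadratic_form_le:
  assumes diag: "\<And>k. k < K \<Longrightarrow> op_norm_mat (diag_noise_mat m \<Psi> x k) \<le> b k"
    and off: "op_norm_mat (offdiag_noise_mat (m * K) m \<Psi> x) \<le> b'"
  shows "(\<Sum>i<m*K. \<Sum>j<m*K. noise m \<Psi> x i j * u i * u j) \<le> (\<Sum>i<m*K. (b (i div m) + b') * (u i)\<^sup>2)"
proof -
  let ?W = "noise m \<Psi> x"
  have "(\<Sum>i<m*K. \<Sum>j<m*K. ?W i j * u i * u j)
    = (\<Sum>i<m*K. \<Sum>j<m*K. if i div m = j div m then ?W i j * u i * u j else 0)
      + (\<Sum>i<m*K. \<Sum>j<m*K. offdiag_noise_mat (m * K) m \<Psi> x $$ (i, j) * u i * u j)"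
    unfolding sum.distrib[symmetric] by (intro sum.cong refl) (auto simp: offdiag_noise_mat_def)
  also have "(\<Sum>i<m*K. \<Sum>j<m*K. if i div m = j div m then ?W i j * u i * u j else 0)
    \<le> (\<Sum>k<K. b k * (\<Sum>i\<in>blk m k. (u i)\<^sup>2))"
    unfolding sum_same_block
  proof (rule sum_mono)
    fix k assume "k \<in> {..<K}"
    have "(\<Sum>i\<in>blk m k. \<Sum>j\<in>blk m k. ?W i j * u i * u j)
      = (\<Sum>i<m. \<Sum>j<m. diag_noise_mat m \<Psi> x k $$ (i, j) * u (k * m + i) * u (k * m + j))"
      by (simp add: sum_blk_shift diag_noise_mat_def)
    also have "\<dots> \<le> op_norm_mat (diag_noise_mat m \<Psi> x k) * (\<Sum>i<m. (u (k * m + i))\<^sup>2)"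
      by (rule quadratic_form_le_op_norm) (simp add: diag_noise_mat_def)
    also have "\<dots> \<le> b k * (\<Sum>i<m. (u (k * m + i))\<^sup>2)"
      using diag \<open>k \<in> {..<K}\<close> by (intro mult_right_mono sum_nonneg) auto
    finally show "(\<Sum>i\<in>blk m k. \<Sum>j\<in>blk m k. ?W i j * u i * u j) \<le> b k * (\<Sum>i\<in>blk m k. (u i)\<^sup>2)"
      by (simp add: sum_blk_shift)
  qed
  also have "(\<Sum>k<K. b k * (\<Sum>i\<in>blk m k. (u i)\<^sup>2)) = (\<Sum>i<m*K. b (i div m) * (u i)\<^sup>2)"
    unfolding sum_blocks sum_distrib_left by (intro sum.cong refl) auto
  also have "(\<Sum>i<m*K. \<Sum>j<m*K. offdiag_noise_mat (m * K) m \<Psi> x $$ (i, j) * u i * u j)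
    \<le> op_norm_mat (offdiag_noise_mat (m * K) m \<Psi> x) * (\<Sum>i<m*K. (u i)\<^sup>2)"
    by (rule quadratic_form_le_op_norm) (simp add: offdiag_noise_mat_def)
  also have "\<dots> \<le> b' * (\<Sum>i<m*K. (u i)\<^sup>2)"
    using off by (intro mult_right_mono sum_nonneg) auto
  finally show ?thesis
    by (simp add: sum_distrib_left sum.distrib[symmetric] distrib_right)
qed

text \<open>The deterministic core. \<open>\<beta>\<close> is m times the multiplier: for connection
  probability t, two upper degree bounds minus one lower edge count leave the mean t + t - t, three
  fluctuations of size 2 sqrt(w t m), and two linear terms \<open>w\<close>.\<close>

lemma exact_recovery_of_concentration:
  fixes \<Psi> :: "real mat" and m K :: nat and b :: "nat \<Rightarrow> real" and b' q w\<^sub>1 w \<beta> :: real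
    and x :: "nat \<times> nat \<Rightarrow> bool"
  defines "A \<equiv> adj_mat (m * K) x"
  assumes m: "m > 0" and K: "K > 0" and \<Psi>: "\<Psi> \<in> carrier_mat K K" "symmetric_mat \<Psi>"
    and \<Psi>_bd: "\<And>k l. \<lbrakk>k < K; l < K\<rbrakk> \<Longrightarrow> 0 \<le> \<Psi> $$ (k, l)"
    and \<Psi>_off: "\<And>k l. \<lbrakk>k < K; l < K; k \<noteq> l\<rbrakk> \<Longrightarrow> \<Psi> $$ (k, l) \<le> q"
    and w: "0 \<le> w" and w1: "0 \<le> w\<^sub>1"
    and diag: "\<And>k. k < K \<Longrightarrow> op_norm_mat (diag_noise_mat m \<Psi> x k) \<le> b k"
    and off: "op_norm_mat (offdiag_noise_mat (m * K) m \<Psi> x) \<le> b'"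
    and deg_in: "\<And>i. i < m * K \<Longrightarrow> \<Psi> $$ (i div m, i div m) * real (m - 1)
        - sqrt (2 * w\<^sub>1 * (\<Psi> $$ (i div m, i div m) * real (m - 1))) \<le> (\<Sum>j\<in>blk m (i div m). A $$ (i, j))"
    and deg_out: "\<And>i l. \<lbrakk>i < m * K; l < K; l \<noteq> i div m\<rbrakk> \<Longrightarrow> (\<Sum>j\<in>blk m l. A $$ (i, j))
        \<le> \<Psi> $$ (i div m, l) * m + 2 * sqrt (w * (\<Psi> $$ (i div m, l) * m)) + w"
    and cut: "\<And>k l. \<lbrakk>k < K; l < K; k \<noteq> l\<rbrakk> \<Longrightarrow> \<Psi> $$ (k, l) * (real m)\<^sup>2 - sqrt (2 * w * (\<Psi> $$ (k, l) * (real m)\<^sup>2))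
        \<le> (\<Sum>i\<in>blk m k. \<Sum>j\<in>blk m l. A $$ (i, j))"
    and \<beta>: "\<beta> = q * m + 6 * sqrt (w * (q * m)) + 2 * w"
    and margin: "\<And>k. k < K \<Longrightarrow> b k + b' < \<Psi> $$ (k, k) * m - sqrt (2 * w\<^sub>1 * (\<Psi> $$ (k, k) * m)) - \<beta>"
  shows "sdp_solutions (m * K) K A = {cluster_mat m K}"
proof (rule sdp_solutions_cluster_mat[OF m K, where \<mu> = "\<beta> / m"])
  let ?n = "m * K"
  show "A \<in> carrier_mat ?n ?n" "symmetric_mat A"
    by (simp_all add: A_def adj_mat_carrier symmetric_adj_mat)
  show "(\<Sum>j\<in>blk m l. A $$ (i, j)) / m + (\<Sum>i\<in>blk m k. A $$ (j, i)) / m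
        - (\<Sum>i\<in>blk m k. \<Sum>j\<in>blk m l. A $$ (i, j)) / m^2 \<le> \<beta> / m"
    if kl: "k < K" "l < K" "k \<noteq> l" and i: "i \<in> blk m k" and j: "j \<in> blk m l" for k l i j
  proof -
    define t where "t = \<Psi> $$ (k, l)"
    define rt where "rt = sqrt (w * (t * m))"
    have t: "0 \<le> t" "t \<le> q" "\<Psi> $$ (l, k) = t"
      using \<Psi>_bd \<Psi>_off kl \<Psi> by (auto simp: t_def symmetric_mat_iff)
    have 1: "(\<Sum>j\<in>blk m l. A $$ (i, j)) \<le> t * m + 2 * rt + w"
      using deg_out[OF blk_less[OF i kl(1)] kl(2)] kl(3) i by (simp add: t_def rt_def)
    have 2: "(\<Sum>i\<in>blk m k. A $$ (j, i)) \<le> t * m + 2 * rt + w"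
      using deg_out[OF blk_less[OF j kl(2)] kl(1)] kl(3) j t(3) by (simp add: rt_def)
    \<comment> \<open>The edge count fluctuates far less after division by m^2; the generous bound
      lets it merge with the two degree terms.\<close>
    have "sqrt (2 * w * (t * (real m)\<^sup>2)) \<le> 2 * rt * m"
    proof (rule real_le_lsqrt)
      have "2 * w * (t * (real m)\<^sup>2) * 1 \<le> 2 * w * (t * (real m)\<^sup>2) * (2 * m)"
        using w t m by (intro mult_left_mono) auto
      then show "2 * w * (t * (real m)\<^sup>2) \<le> (2 * rt * m)\<^sup>2"
        using w t m by (simp add: rt_def power_mult_distrib power2_eq_square algebra_simps)
    qed (use w t in \<open>auto simp: rt_def\<close>)
    then have 3: "t * (real m)\<^sup>2 - 2 * rt * m \<le> (\<Sum>i\<in>blk m k. \<Sum>j\<in>blk m l. A $$ (i, j))"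
      using cut[OF kl] by (simp add: t_def)
    have "(\<Sum>j\<in>blk m l. A $$ (i, j)) / m + (\<Sum>i\<in>blk m k. A $$ (j, i)) / m
        - (\<Sum>i\<in>blk m k. \<Sum>j\<in>blk m l. A $$ (i, j)) / m^2
      \<le> (t * m + 2 * rt + w) / m + (t * m + 2 * rt + w) / m - (t * (real m)\<^sup>2 - 2 * rt * m) / m^2"
      using 1 2 3 m by (intro diff_mono add_mono divide_right_mono) auto
    also have "\<dots> = (t * m + 6 * rt + 2 * w) / m"
      using m by (simp add: field_simps power2_eq_square)
    also have "\<dots> \<le> \<beta> / m"
    proof (rule divide_right_mono)
      have "rt \<le> sqrt (w * (q * m))"
        unfolding rt_def using t w by (intro real_sqrt_le_mono mult_left_mono mult_right_mono) auto
      moreover have "t * m \<le> q * m" using t by (intro mult_right_mono) auto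
      ultimately show "t * m + 6 * rt + 2 * w \<le> \<beta>" unfolding \<beta> by linarith
    qed simp
    finally show ?thesis .
  qed
  show "(\<Sum>i<?n. \<Sum>j<?n. A $$ (i, j) * u i * u j)
        < (\<Sum>i<?n. ((\<Sum>j\<in>blk m (i div m). A $$ (i, j)) - \<beta> / m * m) * (u i)\<^sup>2)"
    if u: "\<And>k. k < K \<Longrightarrow> (\<Sum>i\<in>blk m k. u i) = 0" and nz: "\<exists>i<?n. u i \<noteq> 0" for u
  proof -
    let ?p = "\<lambda>i. \<Psi> $$ (i div m, i div m)"
    \<comment> \<open>\<open>A\<close> and the noise vanish on the diagonal but the block mean is
      \<open>?p i\<close> there. The resulting correction \<open>- ?p i\<close> exactly compensates
      for the mere \<open>m - 1\<close> possible neighbours in the own block.\<close>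
    have "(\<Sum>i<?n. \<Sum>j<?n. A $$ (i, j) * u i * u j)
      = (\<Sum>i<?n. \<Sum>j<?n. noise m \<Psi> x i j * u i * u j)
        + (\<Sum>i<?n. u i * (\<Sum>j<?n. \<Psi> $$ (i div m, j div m) * u j))
        - (\<Sum>i<?n. \<Sum>j<?n. if i = j then ?p i * u i * u j else 0)"
      unfolding sum_distrib_left sum.distrib[symmetric] sum_subtractf[symmetric]
      by (intro sum.cong refl)
        (auto simp: A_def adj_mat_index noise_def edge_prob_edge[OF \<Psi>] algebra_simps)
    also have "(\<Sum>i<?n. u i * (\<Sum>j<?n. \<Psi> $$ (i div m, j div m) * u j)) = 0"
    proof -
      have "(\<Sum>j<?n. \<Psi> $$ (i div m, j div m) * u j) = 0" for i
        by (rule sum_block_constant_mult[where g = "\<lambda>l. \<Psi> $$ (i div m, l)"]) (rule u)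
      then show ?thesis by simp
    qed
    also have "(\<Sum>i<?n. \<Sum>j<?n. noise m \<Psi> x i j * u i * u j) \<le> (\<Sum>i<?n. (b (i div m) + b') * (u i)\<^sup>2)"
      by (rule noise_quadratic_form_le[OF diag off])
    also have "(\<Sum>i<?n. \<Sum>j<?n. if i = j then ?p i * u i * u j else 0) = (\<Sum>i<?n. ?p i * (u i)\<^sup>2)"
      by (simp add: power2_eq_square mult.assoc)
    also have "(\<Sum>i<?n. (b (i div m) + b') * (u i)\<^sup>2) + 0 - (\<Sum>i<?n. ?p i * (u i)\<^sup>2)
      = (\<Sum>i<?n. (b (i div m) + b' - ?p i) * (u i)\<^sup>2)"
      by (simp add: sum_subtractf algebra_simps)
    also have "\<dots> < (\<Sum>i<?n. ((\<Sum>j\<in>blk m (i div m). A $$ (i, j)) - \<beta> / m * m) * (u i)\<^sup>2)"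
    proof -
      have less: "b (i div m) + b' - ?p i < (\<Sum>j\<in>blk m (i div m). A $$ (i, j)) - \<beta> / m * m" if "i < ?n" for i
      proof -
        have k: "i div m < K" using that by (rule div_less_blocks)
        have "sqrt (2 * w\<^sub>1 * (?p i * real (m - 1))) \<le> sqrt (2 * w\<^sub>1 * (?p i * m))"
          using w1 \<Psi>_bd[OF k k] by (intro real_sqrt_le_mono mult_left_mono) auto
        moreover have "?p i * real (m - 1) = ?p i * m - ?p i" using m by (simp add: of_nat_diff algebra_simps)
        moreover have "\<beta> / m * m = \<beta>" using m by simp
        ultimately show ?thesis using margin[OF k] deg_in[OF that] by linarith
      qed
      obtain i where i: "i < ?n" "u i \<noteq> 0" using nz by blast
      show ?thesis
      proof (rule sum_strict_mono_ex1)
        show "\<forall>i\<in>{..<?n}. (b (i div m) + b' - ?p i) * (u i)\<^sup>2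
          \<le> ((\<Sum>j\<in>blk m (i div m). A $$ (i, j)) - \<beta> / m * m) * (u i)\<^sup>2"
        proof (intro ballI mult_right_mono)
          fix i assume "i \<in> {..<?n}"
          then show "b (i div m) + b' - ?p i \<le> (\<Sum>j\<in>blk m (i div m). A $$ (i, j)) - \<beta> / m * m"
            using less[of i] by (intro less_imp_le) simp
        qed simp
        show "\<exists>i\<in>{..<?n}. (b (i div m) + b' - ?p i) * (u i)\<^sup>2
          < ((\<Sum>j\<in>blk m (i div m). A $$ (i, j)) - \<beta> / m * m) * (u i)\<^sup>2"
        proof (rule bexI[of _ i])
          show "(b (i div m) + b' - ?p i) * (u i)\<^sup>2
            < ((\<Sum>j\<in>blk m (i div m). A $$ (i, j)) - \<beta> / m * m) * (u i)\<^sup>2"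
            by (rule mult_strict_right_mono[OF less[OF i(1)]]) (use i in simp)
        qed (use i in simp)
      qed simp
    qed
    finally show ?thesis by simp
  qed
qed

section \<open>Probability of recovery\<close>

lemma p_minus_le: "k < K \<Longrightarrow> p_minus K \<Psi> \<le> \<Psi> $$ (k, k)"
  unfolding p_minus_def by (rule Min_le) auto

lemma q_plus_ge:
  assumes "k < K" "l < K" "k \<noteq> l"
  shows "\<Psi> $$ (k, l) \<le> q_plus K \<Psi>"
proof -
  have "finite {\<Psi> $$ (k, l) |k l. k < K \<and> l < K \<and> k \<noteq> l}"
    by (rule finite_subset[of _ "(\<lambda>(k, l). \<Psi> $$ (k, l)) ` ({..<K} \<times> {..<K})"]) auto
  then show ?thesis unfolding q_plus_def using assms by (intro Max_ge) auto
qed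

section \<open>Degrees and edge counts as sums over distinct edges\<close>

lemma adj_mat_degree:
  assumes i: "i < m * K" and l: "l < K"
  shows "(\<Sum>j\<in>blk m l. adj_mat (m * K) x $$ (i, j)) = (\<Sum>e\<in>edge i ` (blk m l - {i}). of_bool (x e))"
proof -
  have "(\<Sum>j\<in>blk m l. adj_mat (m * K) x $$ (i, j)) = (\<Sum>j\<in>blk m l - {i}. adj_mat (m * K) x $$ (i, j))"
    by (rule sum.mono_neutral_right) (use i in \<open>auto simp: adj_mat_index\<close>)
  also have "\<dots> = (\<Sum>j\<in>blk m l - {i}. of_bool (x (edge i j)))"
    by (intro sum.cong refl) (use i in \<open>auto simp: adj_mat_index blk_less[OF _ l]\<close>)
  also have "\<dots> = (\<Sum>e\<in>edge i ` (blk m l - {i}). of_bool (x e))"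
    by (simp add: sum.reindex[OF inj_on_edge])
  finally show ?thesis .
qed

text \<open>An unordered pair between two different blocks has only one orientation; inside one
  block both orientations would give the same edge.\<close>

lemma inj_on_edge_blocks:
  assumes "k \<noteq> l"
  shows "inj_on (\<lambda>(i, j). edge i j) (blk m k \<times> blk m l)"
proof (rule inj_onI, clarify)
  fix i j i' j' assume mem: "i \<in> blk m k" "j \<in> blk m l" "i' \<in> blk m k" "j' \<in> blk m l"
    and eq: "edge i j = edge i' j'"
  have "i = i' \<and> j = j' \<or> i = j' \<and> j = i'"
    using eq by (auto simp: edge_def min_def max_def split: if_splits)
  moreover have "i \<noteq> j'" using mem(1,4) assms by (metis div_blk)
  ultimately show "i = i' \<and> j = j'" by blast
qed

lemma adj_mat_cut:
  assumes "k < K" "l < K" "k \<noteq> l"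
  shows "(\<Sum>i\<in>blk m k. \<Sum>j\<in>blk m l. adj_mat (m * K) x $$ (i, j))
    = (\<Sum>e\<in>(\<lambda>(i, j). edge i j) ` (blk m k \<times> blk m l). of_bool (x e))"
proof -
  have "(\<Sum>i\<in>blk m k. \<Sum>j\<in>blk m l. adj_mat (m * K) x $$ (i, j))
    = (\<Sum>i\<in>blk m k. \<Sum>j\<in>blk m l. of_bool (x (edge i j)))"
  proof (intro sum.cong refl)
    fix i j assume ij: "i \<in> blk m k" "j \<in> blk m l"
    then have "i \<noteq> j" using assms(3) by (metis div_blk)
    then show "adj_mat (m * K) x $$ (i, j) = of_bool (x (edge i j))"
      using ij by (simp add: adj_mat_index blk_less[OF _ assms(1)] blk_less[OF _ assms(2)])
  qed
  also have "\<dots> = (\<Sum>(i, j)\<in>blk m k \<times> blk m l. of_bool (x (edge i j)))"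
    by (rule sum.cartesian_product)
  also have "\<dots> = (\<Sum>e\<in>(\<lambda>(i, j). edge i j) ` (blk m k \<times> blk m l). of_bool (x e))"
    unfolding sum.reindex[OF inj_on_edge_blocks[OF assms(3)]] by (simp only: comp_def case_prod_unfold)
  finally show ?thesis .
qed

section \<open>The product law of the edges and its tail bounds\<close>

text \<open>Diagonal pairs are included because the concentration property indexes the diagonal too,
  and each such entry needs its own coordinate; \<open>adj_mat\<close> ignores them.\<close>

definition edge_set :: "nat \<Rightarrow> (nat \<times> nat) set" where
  "edge_set n = {(i, j). i \<le> j \<and> j < n}"

definition edge_law :: "nat \<Rightarrow> nat \<Rightarrow> real mat \<Rightarrow> (nat \<times> nat \<Rightarrow> bool) pmf" where
  "edge_law n m \<Psi> = Pi_pmf (edge_set n) False (\<lambda>e. bernoulli_pmf (edge_prob m \<Psi> e))"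

lemma finite_edge_set: "finite (edge_set n)"
  unfolding edge_set_def by (rule finite_subset[of _ "{..<n} \<times> {..<n}"]) auto

lemma edge_in_edge_set: "i < n \<Longrightarrow> j < n \<Longrightarrow> edge i j \<in> edge_set n"
  by (auto simp: edge_def edge_set_def)

lemma diag_noise_concentration:
  assumes CC: "concentration_constants C C' c r" and m: "m > 0" and k: "k < K"
    and \<Psi>: "\<Psi> $$ (k, k) \<in> {0..1}" and var: "real m * \<Psi> $$ (k, k) \<ge> C' * ln (real m)"
  shows "measure_pmf.prob (edge_law (m * K) m \<Psi>)
      {x. \<not> op_norm_mat (diag_noise_mat m \<Psi> x k) \<le> C * sqrt (\<Psi> $$ (k, k)) * sqrt (real m)}
    \<le> c * real m powr (- r)"
proof -
  \<comment> \<open>Concentration is phrased on the lower triangle, edges are stored as upper pairs: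
    hence the swap, besides the shift into block \<open>k\<close>.\<close>
  define e where "e = (\<lambda>(i, j). (k * m + j, k * m + i))"
  have "k * m + i \<in> blk m k" if "i < m" for i using that by (simp add: blk_def)
  then have less: "k * m + i < m * K" and div: "(k * m + i) div m = k" if "i < m" for i
    using blk_less[OF _ k] that by auto
  have "diag_noise_mat m \<Psi> x k = Matrix.mat m m (\<lambda>(i, j). if (\<lambda>(i, j). i \<noteq> j) (max i j, min i j)
      then of_bool (x (e (max i j, min i j))) - edge_prob m \<Psi> (e (max i j, min i j)) else 0)" for x
    by (intro eq_matI) (auto simp: diag_noise_mat_def noise_def edge_def e_def max_def min_def)
  moreover have "measure_pmf.prob (edge_law (m * K) m \<Psi>)
      {x. \<not> op_norm_mat (Matrix.mat m m (\<lambda>(i, j). if (\<lambda>(i, j). i \<noteq> j) (max i j, min i j)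
          then of_bool (x (e (max i j, min i j))) - edge_prob m \<Psi> (e (max i j, min i j)) else 0))
        \<le> C * sqrt (\<Psi> $$ (k, k)) * sqrt (real m)} \<le> c * real m powr (- r)"
    unfolding edge_law_def
  proof (rule masked_concentration[OF CC])
    show "inj_on e {(i, j). j \<le> i \<and> i < m}" by (auto simp: inj_on_def e_def)
    show "e ` {(i, j). j \<le> i \<and> i < m} \<subseteq> edge_set (m * K)"
      using less by (auto simp: e_def edge_set_def)
    show "0 \<le> edge_prob m \<Psi> (e (i, j)) \<and> edge_prob m \<Psi> (e (i, j)) \<le> 1
        \<and> edge_prob m \<Psi> (e (i, j)) \<le> (sqrt (\<Psi> $$ (k, k)))\<^sup>2"
      if "(\<lambda>(i, j). i \<noteq> j) (i, j)" "j \<le> i" "i < m" for i j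
      using that \<Psi> by (simp add: edge_prob_def e_def div)
  qed (use m \<Psi> var finite_edge_set in auto)
  ultimately show ?thesis by simp
qed

text \<open>Masking the diagonal blocks removes the entries whose variance may exceed
  \<open>\<sigma>\<^sup>2\<close>. As \<open>\<sigma>\<^sup>2\<close> need only dominate the
  remaining probabilities, it can be enlarged until \<open>var\<close> holds.\<close>

lemma offdiag_noise_concentration:
  assumes CC: "concentration_constants C C' c r" and n: "n = m * K" "n > 0"
    and \<Psi>: "\<And>k l. \<lbrakk>k < K; l < K\<rbrakk> \<Longrightarrow> \<Psi> $$ (k, l) \<in> {0..1}"
    and \<sigma>: "\<sigma> \<ge> 0" "\<And>k l. \<lbrakk>k < K; l < K; k \<noteq> l\<rbrakk> \<Longrightarrow> \<Psi> $$ (k, l) \<le> \<sigma>\<^sup>2"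
    and var: "real n * \<sigma>\<^sup>2 \<ge> C' * ln (real n)"
  shows "measure_pmf.prob (edge_law n m \<Psi>)
      {x. \<not> op_norm_mat (offdiag_noise_mat n m \<Psi> x) \<le> C * \<sigma> * sqrt (real n)}
    \<le> c * real n powr (- r)"
proof -
  define e where "e = (\<lambda>(i::nat, j::nat). (j, i))"
  define z where "z = (\<lambda>(i, j). i div m \<noteq> j div m)"
  have "offdiag_noise_mat n m \<Psi> x = Matrix.mat n n (\<lambda>(i, j). if z (max i j, min i j)
      then of_bool (x (e (max i j, min i j))) - edge_prob m \<Psi> (e (max i j, min i j)) else 0)" for x
    by (intro eq_matI) (auto simp: offdiag_noise_mat_def noise_def edge_def e_def z_def max_def min_def)
  moreover have "measure_pmf.prob (edge_law n m \<Psi>)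
      {x. \<not> op_norm_mat (Matrix.mat n n (\<lambda>(i, j). if z (max i j, min i j)
          then of_bool (x (e (max i j, min i j))) - edge_prob m \<Psi> (e (max i j, min i j)) else 0))
        \<le> C * \<sigma> * sqrt (real n)} \<le> c * real n powr (- r)"
    unfolding edge_law_def
  proof (rule masked_concentration[OF CC])
    show "inj_on e {(i, j). j \<le> i \<and> i < n}" by (auto simp: inj_on_def e_def)
    show "e ` {(i, j). j \<le> i \<and> i < n} \<subseteq> edge_set n"
      by (auto simp: e_def edge_set_def)
    show "0 \<le> edge_prob m \<Psi> (e (i, j)) \<and> edge_prob m \<Psi> (e (i, j)) \<le> 1
        \<and> edge_prob m \<Psi> (e (i, j)) \<le> \<sigma>\<^sup>2"
      if "z (i, j)" "j \<le> i" "i < n" for i j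
    proof -
      have "i div m < K" "j div m < K"
        using that div_less_blocks[of _ m K] unfolding n by auto
      then show ?thesis using \<Psi>[of "j div m" "i div m"] \<sigma>(2)[of "j div m" "i div m"] that
        by (auto simp: edge_prob_def e_def z_def)
    qed
  qed (use n \<sigma> var finite_edge_set in \<open>auto simp: z_def\<close>)
  ultimately show ?thesis by simp
qed

lemma prob_UN_le:
  assumes "finite I" "\<And>i. i \<in> I \<Longrightarrow> measure_pmf.prob P (B i) \<le> b" "real (card I) \<le> N" "0 \<le> b"
  shows "measure_pmf.prob P (\<Union>i\<in>I. B i) \<le> N * b"
proof -
  have "measure_pmf.prob P (\<Union>i\<in>I. B i) \<le> (\<Sum>i\<in>I. measure_pmf.prob P (B i))"
    using assms(1) by (intro measure_pmf.finite_measure_subadditive_finite) auto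
  also have "\<dots> \<le> (\<Sum>i\<in>I. b)" by (intro sum_mono assms(2))
  also have "\<dots> \<le> N * b" using assms(3,4) by (simp add: mult_right_mono)
  finally show ?thesis .
qed

text \<open>A bootstrap: ln n >= ln 2 >= 2/3 makes the linear bound give n >= 96, which exceeds 81
  >= e^4.\<close>

lemma ln_ge_4_of_linear_bound:
  assumes n: "n \<ge> 2" and bound: "144 * ln (real n) \<le> real n"
  shows "4 \<le> ln (real n)"
proof -
  have "2 / 3 \<le> ln (2::real)" by (rule ln2_ge_two_thirds)
  also have "ln 2 \<le> ln (real n)" using n by (simp add: ln_le_cancel_iff)
  finally have "96 \<le> real n" using bound by linarith
  moreover have "exp (4::real) \<le> 81"
  proof -
    have "exp (4::real) = exp 1 ^ 4" by (simp add: exp_of_nat_mult[symmetric])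
    also have "\<dots> \<le> 3 ^ 4" by (intro power_mono exp_le) simp
    finally show ?thesis by simp
  qed
  ultimately have "ln (exp 4) \<le> ln (real n)" by (subst ln_le_cancel_iff) auto
  then show ?thesis by simp
qed

lemma degree_in_tail:
  assumes \<Psi>: "\<Psi> \<in> carrier_mat K K" "symmetric_mat \<Psi>" "\<And>k l. \<lbrakk>k < K; l < K\<rbrakk> \<Longrightarrow> \<Psi> $$ (k, l) \<in> {0..1}"
    and i: "i < m * K" and w: "0 \<le> w" and m: "m > 0"
  shows "measure_pmf.prob (edge_law (m * K) m \<Psi>)
    {x. (\<Sum>j\<in>blk m (i div m). adj_mat (m * K) x $$ (i, j))
      < \<Psi> $$ (i div m, i div m) * real (m - 1) - sqrt (2 * w * (\<Psi> $$ (i div m, i div m) * real (m - 1)))}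
    \<le> exp (- w)"
proof -
  let ?k = "i div m"
  let ?T = "edge i ` (blk m ?k - {i})"
  have k: "?k < K" using i by (rule div_less_blocks)
  have "card ?T = m - 1"
    using m by (subst card_image[OF inj_on_edge]) (simp add: mem_blk_iff del: div_blk)
  moreover have "edge_prob m \<Psi> e = \<Psi> $$ (?k, ?k)" if "e \<in> ?T" for e
    using that edge_prob_edge[OF \<Psi>(1,2) i] blk_less[OF _ k] by auto
  moreover have "?T \<subseteq> edge_set (m * K)"
    using i blk_less[OF _ k] by (auto intro!: edge_in_edge_set)
  ultimately show ?thesis
    using bernoulli_sum_lower_tail[OF finite_edge_set, of ?T "m * K" "edge_prob m \<Psi>" "\<Psi> $$ (?k, ?k)" w]
      \<Psi>(3)[OF k k] w by (simp add: adj_mat_degree[OF i k] edge_law_def)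
qed

lemma degree_out_tail:
  assumes \<Psi>: "\<Psi> \<in> carrier_mat K K" "symmetric_mat \<Psi>" "\<And>k l. \<lbrakk>k < K; l < K\<rbrakk> \<Longrightarrow> \<Psi> $$ (k, l) \<in> {0..1}"
    and i: "i < m * K" and l: "l < K" "l \<noteq> i div m" and w: "0 \<le> w"
  shows "measure_pmf.prob (edge_law (m * K) m \<Psi>)
    {x. \<Psi> $$ (i div m, l) * m + 2 * sqrt (w * (\<Psi> $$ (i div m, l) * m)) + w
      < (\<Sum>j\<in>blk m l. adj_mat (m * K) x $$ (i, j))} \<le> exp (- w)"
proof -
  let ?k = "i div m"
  let ?T = "edge i ` (blk m l - {i})"
  have k: "?k < K" using i by (rule div_less_blocks)
  have "i \<notin> blk m l" using l(2) by auto
  then have "card ?T = m"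
    by (subst card_image[OF inj_on_edge]) simp
  moreover have "edge_prob m \<Psi> e = \<Psi> $$ (?k, l)" if "e \<in> ?T" for e
    using that edge_prob_edge[OF \<Psi>(1,2) i] blk_less[OF _ l(1)] by auto
  moreover have "?T \<subseteq> edge_set (m * K)"
    using i blk_less[OF _ l(1)] by (auto intro!: edge_in_edge_set)
  ultimately show ?thesis
    using bernoulli_sum_upper_tail[OF finite_edge_set, of ?T "m * K" "edge_prob m \<Psi>" "\<Psi> $$ (?k, l)" w]
      \<Psi>(3)[OF k l(1)] w by (simp add: adj_mat_degree[OF i l(1)] edge_law_def)
qed

lemma cut_tail:
  assumes \<Psi>: "\<Psi> \<in> carrier_mat K K" "symmetric_mat \<Psi>" "\<And>k l. \<lbrakk>k < K; l < K\<rbrakk> \<Longrightarrow> \<Psi> $$ (k, l) \<in> {0..1}"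
    and kl: "k < K" "l < K" "k \<noteq> l" and w: "0 \<le> w"
  shows "measure_pmf.prob (edge_law (m * K) m \<Psi>)
    {x. (\<Sum>i\<in>blk m k. \<Sum>j\<in>blk m l. adj_mat (m * K) x $$ (i, j))
      < \<Psi> $$ (k, l) * (real m)\<^sup>2 - sqrt (2 * w * (\<Psi> $$ (k, l) * (real m)\<^sup>2))} \<le> exp (- w)"
proof -
  let ?T = "(\<lambda>(i, j). edge i j) ` (blk m k \<times> blk m l)"
  have "real (card ?T) = (real m)\<^sup>2"
    by (simp add: card_image[OF inj_on_edge_blocks[OF kl(3)]] card_cartesian_product power2_eq_square)
  moreover have "edge_prob m \<Psi> e = \<Psi> $$ (k, l)" if "e \<in> ?T" for e
    using that edge_prob_edge[OF \<Psi>(1,2) blk_less[OF _ kl(1)] blk_less[OF _ kl(2)]] by auto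
  moreover have "?T \<subseteq> edge_set (m * K)"
    using blk_less[OF _ kl(1)] blk_less[OF _ kl(2)] by (auto intro!: edge_in_edge_set)
  ultimately show ?thesis
    using bernoulli_sum_lower_tail[OF finite_edge_set, of ?T "m * K" "edge_prob m \<Psi>" "\<Psi> $$ (k, l)" w]
      \<Psi>(3)[OF kl(1,2)] w unfolding adj_mat_cut[OF kl] edge_law_def by simp
qed

text \<open>\<open>w\<^sub>1\<close> and \<open>w\<close> are the Chernoff exponents that make the union bounds over \<open>n\<close> vertices and
  over \<open>n K\<close> pairs sum to \<open>n powr - c\<^sub>1\<close> and \<open>n powr - c\<^sub>2 / m\<close>.\<close>
lemma edge_law_exact_recovery:
  fixes \<Psi> :: "real mat" and m K n :: nat and C C' c r c\<^sub>1 c\<^sub>2 D p q :: real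
  assumes CC: "concentration_constants C C' c r"
    and m: "m \<ge> 1" and K: "K \<ge> 2" and n: "n = m * K"
    and \<Psi>: "\<Psi> \<in> carrier_mat K K" "symmetric_mat \<Psi>" "\<And>k l. \<lbrakk>k < K; l < K\<rbrakk> \<Longrightarrow> \<Psi> $$ (k, l) \<in> {0..1}"
    and c1: "c\<^sub>1 > 0" and c2: "c\<^sub>2 > 0"
    and D: "D = max (sqrt (4 * (c\<^sub>1 + 1))) (3 * sqrt (4 * (c\<^sub>2 + 2)))"
    and p: "p = p_minus K \<Psi> * real m / ln (real n)"
    and q: "q = q_plus K \<Psi> * real m / ln (real n)"
    and pC: "p \<ge> C'"
    and gap: "p - q > (C + D) * (sqrt p + sqrt (q * real K))"
  shows "measure_pmf.prob (edge_law n m \<Psi>)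
      {x. sdp_solutions n K (adj_mat n x) \<noteq> {cluster_mat m K}}
    \<le> c * (real K * real m powr (- r) + real n powr (- r))
      + real n powr (- c\<^sub>1) + 2 / real m * real n powr (- c\<^sub>2)"
proof -
  let ?P = "edge_law n m \<Psi>" and ?A = "adj_mat n"
  define L where "L = ln (real n)"
  define p0 q0 where "p0 = p_minus K \<Psi>" and "q0 = q_plus K \<Psi>"
  have C: "C > 0" "C' > 0" "c > 0" "r > 0" using CC by (auto simp: concentration_constants_def)
  have "1 * 2 \<le> m * K" using m K by (intro mult_le_mono) auto
  then have n2: "n \<ge> 2" by (simp add: n)
  have L0: "L > 0" using n2 by (simp add: L_def)
  have pL: "p * L = p0 * m" and qL: "q * L = q0 * m"
    using L0 by (simp_all add: p q p0_def q0_def L_def)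
  have p0: "p0 \<le> \<Psi> $$ (k, k)" if "k < K" for k unfolding p0_def by (rule p_minus_le[OF that])
  have q0: "\<Psi> $$ (k, l) \<le> q0" if "k < K" "l < K" "k \<noteq> l" for k l
    unfolding q0_def by (rule q_plus_ge[OF that])
  have q0_pos: "0 \<le> q0" using q0[of 0 1] \<Psi>(3)[of 0 1] K by simp
  have ppos: "p > 0" using pC C by simp
  have qpos: "q \<ge> 0" using q q0_pos L0 by (simp add: q0_def L_def)
  have p0_pos: "p0 > 0"
  proof -
    have "0 < p0 * m" using ppos L0 pL[symmetric] by simp
    then show ?thesis using m by (simp add: zero_less_mult_iff)
  qed
  have D6: "6 * sqrt 2 \<le> D"
  proof -
    have "3 * sqrt (4 * 2) \<le> 3 * sqrt (4 * (c\<^sub>2 + 2))" using c2 by simp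
    moreover have "3 * sqrt (4 * 2) = 6 * sqrt 2" unfolding real_sqrt_mult real_sqrt_four by simp
    ultimately have "6 * sqrt 2 \<le> 3 * sqrt (4 * (c\<^sub>2 + 2))" by linarith
    then show ?thesis unfolding D by (rule max.coboundedI2)
  qed
  \<comment> \<open>Dropping \<open>q\<close> and dividing the gap by \<open>sqrt p\<close> gives C
    + D < sqrt p, and (6 sqrt 2)^2 = 72.\<close>
  have p72: "72 \<le> p"
  proof -
    have "(C + D) * sqrt p \<le> (C + D) * (sqrt p + sqrt (q * K))"
      using C D6 qpos by (intro mult_left_mono) (auto intro: order_trans[of _ "6 * sqrt 2"])
    then have "(C + D) * sqrt p < sqrt p * sqrt p" using gap qpos ppos by simp
    then have "C + D < sqrt p" by (rule mult_right_less_imp_less) (use ppos in simp)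
    then have "6 * sqrt 2 \<le> sqrt p" using D6 C by linarith
    then have "(6 * sqrt 2)\<^sup>2 \<le> (sqrt p)\<^sup>2" by (intro power_mono) auto
    then show ?thesis using ppos by (simp add: power_mult_distrib)
  qed
  \<comment> \<open>Probabilities are at most 1, so 72 L <= p L = p0 m <= m, and m <= n/2 since
    there are at least two clusters.\<close>
  have L4: "L \<ge> 4"
    unfolding L_def
  proof (rule ln_ge_4_of_linear_bound[OF n2])
    have "p0 \<le> 1" using p0[of 0] \<Psi>(3)[of 0 0] K by simp
    then have "p0 * m \<le> 1 * real m" by (intro mult_right_mono) auto
    moreover have "72 * L \<le> p * L" using p72 L0 by (intro mult_right_mono) auto
    moreover have "real m * 2 \<le> real m * real K" using K by (intro mult_left_mono) auto
    ultimately show "144 * ln (real n) \<le> real n" using pL by (simp add: n L_def)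
  qed
  define w\<^sub>1 w where "w\<^sub>1 = (c\<^sub>1 + 1) * L" and "w = (c\<^sub>2 + 2) * L"
  have w: "0 \<le> w" "0 \<le> w\<^sub>1" using c1 c2 L0 by (simp_all add: w_def w\<^sub>1_def)
  define \<sigma> where "\<sigma> = sqrt (max q0 (p0 / K))"
  define b where "b k = C * sqrt (\<Psi> $$ (k, k)) * sqrt m" for k
  define b' where "b' = C * \<sigma> * sqrt n"
  define \<beta> where "\<beta> = q0 * m + 6 * sqrt (w * (q0 * m)) + 2 * w"
  have \<sigma>: "\<sigma>\<^sup>2 = max q0 (p0 / K)" "0 \<le> \<sigma>" using q0_pos by (auto simp: \<sigma>_def le_max_iff_disj)
  \<comment> \<open>The summand \<open>p0 / K\<close> is chosen so that n times it equals p0 m = p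
    L, which is at least C' log n.\<close>
  have n\<sigma>: "n * \<sigma>\<^sup>2 = max (q * K) p * L"
  proof -
    have "n * \<sigma>\<^sup>2 = max (n * q0) (n * (p0 / K))" by (simp add: \<sigma> max_mult_distrib_left)
    also have "n * q0 = (q * K) * L" using qL by (simp add: n algebra_simps)
    also have "n * (p0 / K) = p * L" using pL K by (simp add: n)
    also have "max ((q * K) * L) (p * L) = max (q * K) p * L" using L0 by (simp add: max_mult_distrib_right)
    finally show ?thesis .
  qed
  define B1 where "B1 k = {x. \<not> op_norm_mat (diag_noise_mat m \<Psi> x k) \<le> b k}" for k
  define B2 where "B2 = {x. \<not> op_norm_mat (offdiag_noise_mat n m \<Psi> x) \<le> b'}"
  define B3 where "B3 i = {x. (\<Sum>j\<in>blk m (i div m). ?A x $$ (i, j)) < \<Psi> $$ (i div m, i div m) * real (m - 1)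
    - sqrt (2 * w\<^sub>1 * (\<Psi> $$ (i div m, i div m) * real (m - 1)))}" for i
  \<comment> \<open>The condition on \<open>l\<close> sits inside the event, so the union can run
    over a full rectangle with empty events for the own block; \<open>B5\<close> does the
    same.\<close>
  define B4 where "B4 = (\<lambda>(i, l). {x. l \<noteq> i div m \<and>
    \<Psi> $$ (i div m, l) * m + 2 * sqrt (w * (\<Psi> $$ (i div m, l) * m)) + w < (\<Sum>j\<in>blk m l. ?A x $$ (i, j))})"
  define B5 where "B5 = (\<lambda>(k, l). {x. k \<noteq> l \<and> (\<Sum>i\<in>blk m k. \<Sum>j\<in>blk m l. ?A x $$ (i, j))
    < \<Psi> $$ (k, l) * (real m)\<^sup>2 - sqrt (2 * w * (\<Psi> $$ (k, l) * (real m)\<^sup>2))})"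
  let ?U1 = "\<Union>k\<in>{..<K}. B1 k" and ?U3 = "\<Union>i\<in>{..<n}. B3 i"
    and ?U4 = "\<Union>e\<in>{..<n} \<times> {..<K}. B4 e" and ?U5 = "\<Union>e\<in>{..<K} \<times> {..<K}. B5 e"
  have margin: "b k + b' < \<Psi> $$ (k, k) * m - sqrt (2 * w\<^sub>1 * (\<Psi> $$ (k, k) * m)) - \<beta>" if k: "k < K" for k
  proof -
    define P where "P = \<Psi> $$ (k, k) * m / L"
    have PL: "P * L = \<Psi> $$ (k, k) * m" using L0 by (simp add: P_def)
    have "p \<le> P"
    proof -
      have "p * L \<le> P * L" unfolding pL PL using p0[OF k] by (intro mult_right_mono) auto
      then show ?thesis using L0 by simp
    qed
    then have "C * sqrt (P * L) + C * sqrt (max (q * K) p * L)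
      < (P - sqrt (2 * (c\<^sub>1 + 1) * P) - (q + 6 * sqrt ((c\<^sub>2 + 2) * q) + 2 * (c\<^sub>2 + 2))) * L"
      using C(1) K L4 ppos qpos c1 c2 D gap by (intro signal_dominates_noise[where D = D]) auto
    moreover have "C * sqrt (P * L) = b k" by (simp add: PL b_def real_sqrt_mult)
    moreover have "C * sqrt (max (q * K) p * L) = b'"
      unfolding n\<sigma>[symmetric] b'_def using \<sigma>(2) by (simp add: real_sqrt_mult)
    moreover have "sqrt (2 * (c\<^sub>1 + 1) * P) * L = sqrt (2 * w\<^sub>1 * (\<Psi> $$ (k, k) * m))"
    proof -
      have "2 * w\<^sub>1 * (\<Psi> $$ (k, k) * m) = 2 * (c\<^sub>1 + 1) * P * L\<^sup>2"
        unfolding PL[symmetric] w\<^sub>1_def by (simp add: power2_eq_square)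
      then show ?thesis using L0 by (simp add: real_sqrt_mult)
    qed
    moreover have "sqrt ((c\<^sub>2 + 2) * q) * L = sqrt (w * (q0 * m))"
    proof -
      have "w * (q0 * m) = (c\<^sub>2 + 2) * q * L\<^sup>2"
        unfolding qL[symmetric] w_def by (simp add: power2_eq_square)
      then show ?thesis using L0 by (simp add: real_sqrt_mult)
    qed
    ultimately show ?thesis unfolding \<beta>_def using PL qL by (simp add: w_def algebra_simps)
  qed
  have "{x. sdp_solutions n K (?A x) \<noteq> {cluster_mat m K}} \<subseteq> ?U1 \<union> B2 \<union> ?U3 \<union> ?U4 \<union> ?U5"
  proof (rule subsetI, rule ccontr)
    fix x assume x: "x \<in> {x. sdp_solutions n K (?A x) \<noteq> {cluster_mat m K}}"
      and good: "x \<notin> ?U1 \<union> B2 \<union> ?U3 \<union> ?U4 \<union> ?U5"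
    have "sdp_solutions (m * K) K (adj_mat (m * K) x) = {cluster_mat m K}"
    proof (rule exact_recovery_of_concentration[OF _ _ \<Psi>(1,2) _ q0 w _ _ _ _ _ \<beta>_def margin])
      show "0 < m" "0 < K" using m K by auto
      show "0 \<le> \<Psi> $$ (k, l)" if "k < K" "l < K" for k l using \<Psi>(3)[OF that] by simp
      show "op_norm_mat (diag_noise_mat m \<Psi> x k) \<le> b k" if "k < K" for k
        using good that by (auto simp: B1_def)
      show "op_norm_mat (offdiag_noise_mat (m * K) m \<Psi> x) \<le> b'"
        using good by (auto simp: B2_def n)
      show "\<Psi> $$ (i div m, i div m) * real (m - 1)
          - sqrt (2 * w\<^sub>1 * (\<Psi> $$ (i div m, i div m) * real (m - 1)))
          \<le> (\<Sum>j\<in>blk m (i div m). adj_mat (m * K) x $$ (i, j))" if "i < m * K" for i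
      proof -
        have "x \<notin> B3 i" using good that by (auto simp: n)
        then show ?thesis by (simp add: B3_def n)
      qed
      show "(\<Sum>j\<in>blk m l. adj_mat (m * K) x $$ (i, j))
          \<le> \<Psi> $$ (i div m, l) * m + 2 * sqrt (w * (\<Psi> $$ (i div m, l) * m)) + w"
        if "i < m * K" "l < K" "l \<noteq> i div m" for i l
      proof -
        have "x \<notin> B4 (i, l)" using good that by (auto simp: n)
        then show ?thesis using that by (simp add: B4_def n)
      qed
      show "\<Psi> $$ (k, l) * (real m)\<^sup>2 - sqrt (2 * w * (\<Psi> $$ (k, l) * (real m)\<^sup>2))
          \<le> (\<Sum>i\<in>blk m k. \<Sum>j\<in>blk m l. adj_mat (m * K) x $$ (i, j))"
        if "k < K" "l < K" "k \<noteq> l" for k l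
      proof -
        have "x \<notin> B5 (k, l)" using good that by auto
        then show ?thesis using that by (simp add: B5_def n)
      qed
    qed
    then show False using x by (simp add: n)
  qed
  then have "measure_pmf.prob ?P {x. sdp_solutions n K (?A x) \<noteq> {cluster_mat m K}}
      \<le> measure_pmf.prob ?P (?U1 \<union> B2 \<union> ?U3 \<union> ?U4 \<union> ?U5)"
    by (intro measure_pmf.finite_measure_mono) auto
  also have "\<dots> \<le> measure_pmf.prob ?P ?U1 + measure_pmf.prob ?P B2 + measure_pmf.prob ?P ?U3
      + measure_pmf.prob ?P ?U4 + measure_pmf.prob ?P ?U5"
    by (intro order_trans[OF measure_Un_le] add_right_mono order_refl) auto
  also have "measure_pmf.prob ?P ?U1 \<le> K * (c * real m powr (- r))"
  proof (rule prob_UN_le)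
    fix k assume "k \<in> {..<K}"
    then have k: "k < K" by simp
    \<comment> \<open>The requirement for a single block follows from the global one since ln m <=
      ln n.\<close>
    have "C' * ln (real m) \<le> p * L"
    proof (rule mult_mono)
      show "ln (real m) \<le> L" using m K by (simp add: L_def n ln_mult)
    qed (use pC ppos m in auto)
    also have "\<dots> \<le> real m * \<Psi> $$ (k, k)"
      unfolding pL mult.commute[of "real m"] using p0[OF k] by (rule mult_right_mono) simp
    finally show "measure_pmf.prob ?P (B1 k) \<le> c * real m powr (- r)"
      unfolding B1_def b_def n
      by (intro diag_noise_concentration[OF CC _ k \<Psi>(3)[OF k k]]) (use m in auto)
  qed (use C in auto)
  also have "measure_pmf.prob ?P B2 \<le> c * real n powr (- r)"
    unfolding B2_def b'_def
  proof (rule offdiag_noise_concentration[OF CC n _ \<Psi>(3) \<sigma>(2)])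
    show "\<Psi> $$ (k, l) \<le> \<sigma>\<^sup>2" if "k < K" "l < K" "k \<noteq> l" for k l
      using q0[OF that] unfolding \<sigma>(1) by simp
    have "C' * L \<le> max (q * K) p * L" using pC L0 by (intro mult_right_mono) auto
    then show "C' * ln (real n) \<le> real n * \<sigma>\<^sup>2" unfolding n\<sigma> by (simp add: L_def)
  qed (use n2 in auto)
  also have "measure_pmf.prob ?P ?U3 \<le> n * exp (- w\<^sub>1)"
  proof (rule prob_UN_le)
    show "measure_pmf.prob ?P (B3 i) \<le> exp (- w\<^sub>1)" if "i \<in> {..<n}" for i
      unfolding B3_def n by (rule degree_in_tail[OF \<Psi>]) (use that m w in \<open>auto simp: n\<close>)
  qed auto
  also have "measure_pmf.prob ?P ?U4 \<le> (n * K) * exp (- w)"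
  proof (rule prob_UN_le)
    fix e assume "e \<in> {..<n} \<times> {..<K}"
    then obtain i l where e: "e = (i, l)" "i < m * K" "l < K" by (auto simp: n)
    show "measure_pmf.prob ?P (B4 e) \<le> exp (- w)"
      using degree_out_tail[OF \<Psi> e(2,3) _ w(1)] by (cases "l = i div m") (auto simp: B4_def e(1) n)
  qed (auto simp: card_cartesian_product)
  also have "measure_pmf.prob ?P ?U5 \<le> (n * K) * exp (- w)"
  proof (rule prob_UN_le)
    fix e assume "e \<in> {..<K} \<times> {..<K}"
    then obtain k l where e: "e = (k, l)" "k < K" "l < K" by auto
    show "measure_pmf.prob ?P (B5 e) \<le> exp (- w)"
      using cut_tail[OF \<Psi> e(2,3) _ w(1)] by (cases "k = l") (auto simp: B5_def e(1) n)
  next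
    \<comment> \<open>The K^2 pairs of blocks are overcounted as n K, to share the rate of the outer
      degrees.\<close>
    have "1 * K * K \<le> m * K * K" using m by (intro mult_le_mono) auto
    then show "real (card ({..<K} \<times> {..<K})) \<le> real (n * K)"
      unfolding n of_nat_le_iff by (simp add: card_cartesian_product)
  qed auto
  also have "n * exp (- w\<^sub>1) = real n powr (- c\<^sub>1)"
  proof -
    have "exp (- w\<^sub>1) = real n powr (- c\<^sub>1 + -1)" using n2 by (simp add: w\<^sub>1_def L_def powr_def algebra_simps)
    also have "\<dots> = real n powr (- c\<^sub>1) * inverse (real n)"
      using n2 unfolding powr_add by (simp add: powr_minus)
    finally show ?thesis using n2 by simp
  qed
  \<comment> \<open>n K = n^2 / m: the 2 in \<open>c\<^sub>2 + 2\<close> pays for n^2, and the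
    factor 1/m of the claim remains.\<close>
  also have "(n * K) * exp (- w) = 1 / real m * real n powr (- c\<^sub>2)"
  proof -
    have "exp (- w) = real n powr (- c\<^sub>2 + -2)" using n2 by (simp add: w_def L_def powr_def algebra_simps)
    also have "\<dots> = real n powr (- c\<^sub>2) * inverse ((real n)\<^sup>2)"
      using n2 unfolding powr_add by (simp add: powr_minus)
    finally have "(n * K) * exp (- w) = real n powr (- c\<^sub>2) * (real (n * K) * inverse ((real n)\<^sup>2))"
      by simp
    also have "real (n * K) * inverse ((real n)\<^sup>2) = 1 / real m"
      using m K by (simp add: n power2_eq_square field_simps)
    finally show ?thesis by simp
  qed
  finally show ?thesis by (simp add: algebra_simps)
qed

section \<open>Transfer to the block model on an arbitrary probability space\<close>

lemma adj_mat_restrict: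
  "adj_mat n (\<lambda>e. if e \<in> {(i, j). i < j \<and> j < n} then x e else False) = adj_mat n x"
  by (intro eq_matI) (auto simp: adj_mat_def edge_def min_def max_def)

theorem corollary4p1:
  fixes M :: "'w measure" and A :: "'w \<Rightarrow> real mat" and \<Psi> :: "real mat"
    and m K n :: nat
    and C C' c r c\<^sub>1 c\<^sub>2 C\<^sub>1 C\<^sub>2 p q :: real
  assumes "concentration_constants C C' c r"
    and "m \<ge> 1" and "K \<ge> 2" and "n = m * K"
    and "balanced_block_model M m K \<Psi> A"
    and "strongly_assortative K \<Psi>"
    and "c\<^sub>1 > 0" and "c\<^sub>2 > 0"
    and "C\<^sub>1 = max C' (4 / 9 * (c\<^sub>1 + 1))"
    and "C\<^sub>2 = C + max (sqrt (4 * (c\<^sub>1 + 1))) (3 * sqrt (4 * (c\<^sub>2 + 2)))"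
    and "p = p_minus K \<Psi> * real m / ln (real n)"
    and "q = q_plus K \<Psi> * real m / ln (real n)"
    and "p \<ge> C\<^sub>1"
    and "p - q > C\<^sub>2 * (sqrt p + sqrt (q * real K))"
  shows "measure M {\<omega> \<in> space M.
           sdp_solutions n K (A \<omega>) = {kronecker_mat (1\<^sub>m K) (ones_mat m)}}
         \<ge> 1 - c * (real K * real m powr (- r) + real n powr (- r))
             - real n powr (- c\<^sub>1) - 2 / real m * real n powr (- c\<^sub>2)"
proof -
  note n = \<open>n = m * K\<close>
  let ?X = "cluster_mat m K"
  define I where "I = {(i::nat, j). i < j \<and> j < n}"
  have BM: "prob_space M" "\<Psi> \<in> carrier_mat K K" "symmetric_mat \<Psi>"
      "\<And>k l. \<lbrakk>k < K; l < K\<rbrakk> \<Longrightarrow> \<Psi> $$ (k, l) \<in> {0..1}"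
      "\<And>\<omega>. \<omega> \<in> space M \<Longrightarrow> A \<omega> \<in> carrier_mat n n"
      "\<And>\<omega>. \<omega> \<in> space M \<Longrightarrow> symmetric_mat (A \<omega>)"
      "\<And>\<omega> i j. \<lbrakk>\<omega> \<in> space M; (i, j) \<in> I\<rbrakk> \<Longrightarrow> A \<omega> $$ (i, j) \<in> {0, 1}"
      "prob_space.indep_vars M (\<lambda>_. borel) (\<lambda>(i, j) \<omega>. A \<omega> $$ (i, j)) I"
      "\<And>i j. (i, j) \<in> I \<Longrightarrow> prob_space.expectation M (\<lambda>\<omega>. A \<omega> $$ (i, j)) = \<Psi> $$ (i div m, j div m)"
    using \<open>balanced_block_model M m K \<Psi> A\<close> unfolding balanced_block_model_def I_def n by auto
  interpret prob_space M by (rule BM(1))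
  let ?P = "edge_law n m \<Psi>"
  define R where "R x \<longleftrightarrow> sdp_solutions n K (adj_mat n x) = {?X}" for x
  have indep: "indep_vars (\<lambda>_. borel) (\<lambda>e \<omega>. A \<omega> $$ e) I"
    using BM(8) by (simp add: case_prod_unfold)
  have I_fin: "finite I" unfolding I_def by (rule finite_subset[of _ "{..<n} \<times> {..<n}"]) auto
  have blocks: "i div m < K" "j div m < K" if "(i, j) \<in> I" for i j
    using that div_less_blocks[of i m K] div_less_blocks[of j m K] by (auto simp: I_def n)
  have "{\<omega> \<in> space M. sdp_solutions n K (A \<omega>) = {?X}}
    = {\<omega> \<in> space M. R (\<lambda>e. e \<in> I \<and> A \<omega> $$ e = 1)}"
  proof (intro Collect_cong conj_cong refl)
    fix \<omega> assume \<omega>: "\<omega> \<in> space M"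
    \<comment> \<open>Equality is claimed off the diagonal only; \<open>adj_mat\<close> has zero
      diagonal, and the solution set does not see the difference.\<close>
    have "A \<omega> $$ (i, j) = adj_mat n (\<lambda>e. e \<in> I \<and> A \<omega> $$ e = 1) $$ (i, j)"
      if ij: "i < n" "j < n" "i \<noteq> j" for i j
    proof -
      have "A \<omega> $$ (i, j) = A \<omega> $$ edge i j"
        using BM(5,6)[OF \<omega>] ij by (auto simp: symmetric_mat_iff edge_def min_def max_def)
      moreover have "edge i j \<in> I" using ij by (auto simp: I_def edge_def)
      ultimately show ?thesis
        using BM(7)[OF \<omega>, of "min i j" "max i j"] ij by (auto simp: adj_mat_index edge_def)
    qed
    then have "sdp_solutions n K (A \<omega>) = sdp_solutions n K (adj_mat n (\<lambda>e. e \<in> I \<and> A \<omega> $$ e = 1))"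
      by (intro sdp_solutions_cong_diagonal[OF BM(5)[OF \<omega>] adj_mat_carrier])
    then show "sdp_solutions n K (A \<omega>) = {?X} \<longleftrightarrow> R (\<lambda>e. e \<in> I \<and> A \<omega> $$ e = 1)"
      unfolding R_def by simp
  qed
  also have "prob \<dots> = measure_pmf.prob (Pi_pmf I False (\<lambda>e. bernoulli_pmf (edge_prob m \<Psi> e))) {x. R x}"
  proof (rule prob_indep_binary_eq_Pi_pmf[OF I_fin indep])
    show "A \<omega> $$ e \<in> {0, 1}" if "e \<in> I" "\<omega> \<in> space M" for e \<omega>
      using BM(7)[OF that(2), of "fst e" "snd e"] that(1) by simp
    show "expectation (\<lambda>\<omega>. A \<omega> $$ e) = edge_prob m \<Psi> e" if "e \<in> I" for e
      using BM(9)[of "fst e" "snd e"] that by (simp add: edge_prob_def)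
    show "0 \<le> edge_prob m \<Psi> e \<and> edge_prob m \<Psi> e \<le> 1" if "e \<in> I" for e
      using BM(4) blocks[of "fst e" "snd e"] that by (simp add: edge_prob_def)
  qed
  \<comment> \<open>The model supplies only strict pairs, so its law is the marginal of
    \<open>edge_law\<close> with the diagonal coordinates forgotten.\<close>
  also have "Pi_pmf I False (\<lambda>e. bernoulli_pmf (edge_prob m \<Psi> e))
    = map_pmf (\<lambda>x e. if e \<in> I then x e else False) ?P"
    unfolding edge_law_def by (rule Pi_pmf_subset[OF finite_edge_set]) (auto simp: I_def edge_set_def)
  also have "measure_pmf.prob \<dots> {x. R x} = measure_pmf.prob ?P {x. R x}"
  proof -
    have "R (\<lambda>e. if e \<in> I then x e else False) = R x" for x
      unfolding R_def I_def adj_mat_restrict ..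
    then show ?thesis unfolding measure_map_pmf vimage_def by (simp only: mem_Collect_eq)
  qed
  also have "{x. R x} = UNIV - {x. sdp_solutions n K (adj_mat n x) \<noteq> {?X}}"
    by (auto simp: R_def)
  also have "measure_pmf.prob ?P \<dots> = 1 - measure_pmf.prob ?P {x. sdp_solutions n K (adj_mat n x) \<noteq> {?X}}"
    using measure_pmf.prob_compl[where M = ?P] by simp
  finally show ?thesis
    using edge_law_exact_recovery[OF assms(1-4) BM(2-4) assms(7,8) refl assms(11,12)] assms(9,10,13,14)
    by simp
qed

end
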